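(* Let $F:\mathbb{R}^n\to\mathbb{R}^n$ be a function in $\mathrm{span}(\Phi_{\rm abs})$ (with a fixed evaluation procedure) and $x^*$ a root of $F$. Assume that the abs-normal form of the tangent mode piecewise linearization $\lozenge_{x^*}F$ has nonsingular block $J$ and $s\le n$, and that $\lozenge_{x^*}F$ satisfies any one of the following (equivalent) conditions: (1) it is stably coherently oriented; (2) it is stably bijective; (3) it is coherently oriented under small perturbations of $Z,L,J,Y,c,b$; (4) it is bijective under small perturbations of $Z,L,J,Y,c,b$; (5) with $S=L-ZJ^{-1}Y$ the associated absolute value equation $z-S|z|=\hat c$ has exactly one solution $z\in\mathbb{R}^s$ for every $\hat c\in\mathbb{R}^s$. Let $\gamma_F>0$ be a second order constant of $F$ valid on a convex neighborhood $K$ of $x^*$, and let $\kappa>0$ be a constant with $\|x-x^*\|\le \kappa\|\lozenge_{x^*}F(x)\|$ for all $x\in\mathbb{R}^n$. Then there exists a ball $B(x^*,\rho)\subseteq K$, $\rho>0$, such that all tangent and secant mode linearizations of $F$ with development points in $B(x^*,\rho)$ are bijective, and both the tangent mode and the secant mode piecewise differentiable Newton's methods converge to $x^*$ from all starting points that lie in $B_R[x^*]$, where $$R:=\frac13\min\left(\rho,\frac{1}{2\kappa\gamma_F}\right).$$ Moreover, for both methods the Newton path (the sequence of iterates) is uniquely determined by the respective starting point(s) of the iteration.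
   Context: Elemental functions and PCS functions: $\Phi$ is a library of elemental functions consisting of the binary arithmetic operations and unary functions (such as $\sin,\cos,\exp,\log,\dots$), each differentiable with (locally) Lipschitz continuous derivative on its open domain; $\Phi_{\rm abs}=\Phi\cup\{\mathrm{abs}\}$ with $\mathrm{abs}(x)=|x|$. A function $F$ belongs to $\mathrm{span}(\Phi_{\rm abs})$ (is piecewise composite smooth, PCS) if it is computed by an evaluation procedure: a finite sequence of intermediate values $v_i$, beginning with the components of $x$ and ending with the components of $F(x)$, in which each further $v_i$ is $v_j\pm v_k$, $v_j * v_k$, $\varphi_i(v_j)$ with $\varphi_i\in\Phi$ unary, or $\mathrm{abs}(v_j)$ for earlier values $v_j,v_k$ (division is written as multiplication by a reciprocal; constants are allowed). The procedure is assumed well defined near all reference points considered. Tangent mode piecewise linearization at $\mathring x$: let $\mathring v_i$ be the values of the procedure at $\mathring x$. Starting from $\Delta x=x-\mathring x$, set $\Delta v_i=\Delta v_j\pm\Delta v_k$ if $v_i=v_j\pm v_k$; $\Delta v_i=\mathring v_j\Delta v_k+\Delta v_j\mathring v_k$ if $v_i=v_j*v_k$; $\Delta v_i=\varphi_i'(\mathring v_j)\Delta v_j$ if $v_i=\varphi_i(v_j)$; $\Delta v_i=|\mathring v_j+\Delta v_j|-|\mathring v_j|$ if $v_i=|v_j|$. The resulting output increment is $\Delta F(\mathring x;\Delta x)$, and $\lozenge_{\mathring x}F(x)=F(\mathring x)+\Delta F(\mathring x;x-\mathring x)$. Secant mode piecewise linearization at $\check x,\hat x$: let $\check v_i,\hat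 v_i$ be the values of the procedure at $\check x$ and $\hat x$, $\mathring v_i=(\check v_i+\hat v_i)/2$, $\mathring x=(\check x+\hat x)/2$, and $\Delta x=x-\mathring x$. Use the same rules for $\pm$ and $*$; for $v_i=\varphi_i(v_j)$ set $\Delta v_i=\mathring c_{ij}\Delta v_j$ with $\mathring c_{ij}=\varphi_i'(\mathring v_j)$ if $\check v_j=\hat v_j$ and $\mathring c_{ij}=(\hat v_i-\check v_i)/(\hat v_j-\check v_j)$ otherwise; for $v_i=|v_j|$ set $\Delta v_i=|\mathring v_j+\Delta v_j|-\mathring v_i$, where $\mathring v_i=(|\check v_j|+|\hat v_j|)/2$. The output increment is $\Delta F(\check x,\hat x;\Delta x)$, and $\lozenge_{\check x}^{\hat x}F(x)=\tfrac12(F(\check x)+F(\hat x))+\Delta F(\check x,\hat x;x-\mathring x)$. Second order constant: $\gamma_F$ is valid on a set $U$ if for all reference points $\mathring x,\check x,\hat x,\mathring y,\check y,\hat y,\mathring z,\check z,\hat z\in U$: for all $x\in U$, $\|F(x)-\lozenge_{\check x}^{\hat x}F(x)\|\le\frac12\gamma_F\|x-\hat x\|\|x-\check x\|$ and $\|F(x)-\lozenge_{\mathring x}F(x)\|\le\frac12\gamma_F\|x-\mathring x\|^2$; and for all $x\in\mathbb{R}^n$, $\|\lozenge_{\check z}^{\hat z}F(x)-\lozenge_{\check y}^{\hat y}F(x)\|\le\gamma_F\max[\|\hat z-\hat y\|\max(\|x-\check y\|,\|x-\check z\|),\ \|\check z-\check y\|\max(\|x-\hat y\|,\|x-\hat z\|)]$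 and $\|\lozenge_{\mathring z}F(x)-\lozenge_{\mathring y}F(x)\|\le\gamma_F\|\mathring z-\mathring y\|\max(\|x-\mathring y\|,\|x-\mathring z\|)$. Abs-normal form (ANF) of a piecewise linear function $x\mapsto y$ on $\mathbb{R}^n$: $z=c+Zx+L|z|$, $y=b+Jx+Y|z|$ with $c\in\mathbb{R}^s$, $Z\in\mathbb{R}^{s\times n}$, $L\in\mathbb{R}^{s\times s}$ strictly lower triangular, $b\in\mathbb{R}^n$, $J\in\mathbb{R}^{n\times n}$, $Y\in\mathbb{R}^{n\times s}$, and $|z|$ componentwise. For $F\in\mathrm{span}(\Phi_{\rm abs})$ with $s$ absolute value calls, let $z\in\mathbb{R}^s$ be the vector of arguments of these calls in order of evaluation, and write $z=G(x,|z|)$, $F(x)=\tilde F(x,|z|)$ with $G,\tilde F$ the smooth (abs-free) parts of the evaluation procedure ($\partial G/\partial|z|$ strictly lower triangular). The ANF of $\lozenge_{\mathring x}F$ has $Z=\partial_xG$, $L=\partial_{|z|}G$, $J=\partial_x\tilde F$, $Y=\partial_{|z|}\tilde F$ evaluated at $(\mathring x,|\mathring z|)$, where $\mathring z=z(\mathring x)$, and $c=G(\mathring x,|\mathring z|)-Z\mathring x-L|\mathring z|$, $b=\tilde F(\mathring x,|\mathring z|)-J\mathring x-Y|\mathring z|$. A piecewise linear function is coherently oriented if the linear parts of all its affine selection functions that coincide with it on a nonempty open set have determinants of the same nonzero sign. A function in ANF is stably coherently oriented (stably bijective) if there is $\varepsilon>0$ such that replacing $Z$ by any $\tilde Z$ with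 $\|\tilde Z-Z\|<\varepsilon$ (other data fixed) gives a coherently oriented (bijective) function. A property holds under small perturbations of $Z,L,J,Y,c,b$ if it holds for all ANFs of the same dimensions ($L$ kept strictly lower triangular) with data within some $\varepsilon>0$ of the given data. Newton's methods: in tangent mode, starting from $x_0$, $x_{j+1}\in\arg\min\{\|x-x_j\|:\lozenge_{x_j}F(x)=0\}$. In secant mode, starting from $x_0,x_1$, $x_{j+1}\in\arg\min\{\|x-\tfrac12(x_j+x_{j-1})\|:\lozenge_{x_{j-1}}^{x_j}F(x)=0\}$. $B(x^*,\rho)$ is the open ball and $B_R[x^*]$ the closed ball about $x^*$. *)

theory Defs
  imports "HOL-Analysis.Analysis"
begin

section \<open>Norms and balls\<close>

text \<open>The norm on $\mathbb{R}^n$ is left arbitrary; it need not be the Euclidean one of the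
  library.\<close>

definition is_norm :: "('a::real_vector \<Rightarrow> real) \<Rightarrow> bool" where
  "is_norm N \<longleftrightarrow>
     (\<forall>x. N x = 0 \<longleftrightarrow> x = 0) \<and>
     (\<forall>a x. N (a *\<^sub>R x) = \<bar>a\<bar> * N x) \<and>
     (\<forall>x y. N (x + y) \<le> N x + N y)"

definition norm_ball :: "('a::real_vector \<Rightarrow> real) \<Rightarrow> 'a \<Rightarrow> real \<Rightarrow> 'a set" where
  "norm_ball N a r = {x. N (x - a) < r}"

definition norm_cball :: "('a::real_vector \<Rightarrow> real) \<Rightarrow> 'a \<Rightarrow> real \<Rightarrow> 'a set" where
  "norm_cball N a r = {x. N (x - a) \<le> r}"


section \<open>Evaluation procedures\<close>

text \<open>The unary elemental functions of a library are pairs of a function and its open domain;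
  the binary arithmetic operations are built into the instructions below.\<close>

definition elemental :: "(real \<Rightarrow> real) \<Rightarrow> real set \<Rightarrow> bool" where
  "elemental \<phi> D \<longleftrightarrow>
     open D \<and> (\<forall>t\<in>D. \<phi> field_differentiable (at t)) \<and>
     (\<forall>t\<in>D. \<exists>e>0. \<exists>C. C-lipschitz_on (ball t e \<inter> D) (deriv \<phi>))"

definition elemental_library :: "((real \<Rightarrow> real) \<times> real set) set \<Rightarrow> bool" where
  "elemental_library \<Phi> \<longleftrightarrow> (\<forall>(\<phi>, D)\<in>\<Phi>. elemental \<phi> D)"

text \<open>A value of the procedure is addressed either as a component of the argument
  or as the result of the instruction with the given (zero-based) number.\<close>

datatype 'n address = Input 'n | Result nat

datatype 'r instr =
    Const real
  | Add 'r 'r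
  | Sub 'r 'r
  | Mul 'r 'r
  | Elem "real \<Rightarrow> real" "real set" 'r
  | Abs 'r

text \<open>The output map says which values are the components of the result. Listing these values
  at the very end of the instruction list is the special case where it points to the last ones.\<close>

record 'n procedure =
  instrs :: "'n address instr list"
  outs :: "'n \<Rightarrow> 'n address"

fun available :: "nat \<Rightarrow> 'n address \<Rightarrow> bool" where
  "available k (Input i) \<longleftrightarrow> True"
| "available k (Result j) \<longleftrightarrow> j < k"

definition procedure_over ::
    "((real \<Rightarrow> real) \<times> real set) set \<Rightarrow> 'n procedure \<Rightarrow> bool" where
  "procedure_over \<Phi> P \<longleftrightarrow>
     (\<forall>k<length (instrs P). \<forall>r\<in>set_instr (instrs P ! k). available k r) \<and>
     (\<forall>\<phi> D r. Elem \<phi> D r \<in> set (instrs P) \<longrightarrow> (\<phi>, D) \<in> \<Phi>) \<and>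
     (\<forall>i. available (length (instrs P)) (outs P i))"

fun lookup :: "real^'n \<Rightarrow> real list \<Rightarrow> 'n address \<Rightarrow> real" where
  "lookup x vs (Input i) = x $ i"
| "lookup x vs (Result j) = vs ! j"

text \<open>Each instruction appends one value, computed from the values obtained so far.\<close>

definition run :: "(real list \<Rightarrow> 'r instr \<Rightarrow> real) \<Rightarrow> 'r instr list \<Rightarrow> real list" where
  "run step is = foldl (\<lambda>vs ins. vs @ [step vs ins]) [] is"

fun eval_step :: "real^'n \<Rightarrow> real list \<Rightarrow> 'n address instr \<Rightarrow> real" where
  "eval_step x vs (Const a) = a"
| "eval_step x vs (Add j k) = lookup x vs j + lookup x vs k"
| "eval_step x vs (Sub j k) = lookup x vs j - lookup x vs k"
| "eval_step x vs (Mul j k) = lookup x vs j * lookup x vs k"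
| "eval_step x vs (Elem \<phi> D j) = \<phi> (lookup x vs j)"
| "eval_step x vs (Abs j) = \<bar>lookup x vs j\<bar>"

definition eval_list :: "'n procedure \<Rightarrow> real^'n \<Rightarrow> real list" where
  "eval_list P x = run (eval_step x) (instrs P)"

definition eval_at :: "'n procedure \<Rightarrow> real^'n \<Rightarrow> 'n address \<Rightarrow> real" where
  "eval_at P x r = lookup x (eval_list P x) r"

definition eval_proc :: "'n procedure \<Rightarrow> real^'n \<Rightarrow> real^'n" where
  "eval_proc P x = (\<chi> i. eval_at P x (outs P i))"

definition well_defined_at :: "'n procedure \<Rightarrow> real^'n \<Rightarrow> bool" where
  "well_defined_at P x \<longleftrightarrow>
     (\<forall>\<phi> D r. Elem \<phi> D r \<in> set (instrs P) \<longrightarrow> eval_at P x r \<in> D)"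

definition computes_near :: "'n procedure \<Rightarrow> (real^'n \<Rightarrow> real^'n) \<Rightarrow> real^'n \<Rightarrow> bool" where
  "computes_near P F x \<longleftrightarrow>
     (\<forall>\<^sub>F y in nhds x. well_defined_at P y \<and> F y = eval_proc P y)"


section \<open>Piecewise linearizations\<close>

fun tangent_step ::
    "'n procedure \<Rightarrow> real^'n \<Rightarrow> real^'n \<Rightarrow> real list \<Rightarrow> 'n address instr \<Rightarrow> real" where
  "tangent_step P xo dx ds (Const a) = 0"
| "tangent_step P xo dx ds (Add j k) = lookup dx ds j + lookup dx ds k"
| "tangent_step P xo dx ds (Sub j k) = lookup dx ds j - lookup dx ds k"
| "tangent_step P xo dx ds (Mul j k) =
     eval_at P xo j * lookup dx ds k + lookup dx ds j * eval_at P xo k"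
| "tangent_step P xo dx ds (Elem \<phi> D j) = deriv \<phi> (eval_at P xo j) * lookup dx ds j"
| "tangent_step P xo dx ds (Abs j) =
     \<bar>eval_at P xo j + lookup dx ds j\<bar> - \<bar>eval_at P xo j\<bar>"

definition tangent_increment :: "'n procedure \<Rightarrow> real^'n \<Rightarrow> real^'n \<Rightarrow> real^'n" where
  "tangent_increment P xo dx =
     (\<chi> i. lookup dx (run (tangent_step P xo dx) (instrs P)) (outs P i))"

definition tangent_lin :: "'n procedure \<Rightarrow> real^'n \<Rightarrow> real^'n \<Rightarrow> real^'n" where
  "tangent_lin P xo x = eval_proc P xo + tangent_increment P xo (x - xo)"

definition mid_at :: "'n procedure \<Rightarrow> real^'n \<Rightarrow> real^'n \<Rightarrow> 'n address \<Rightarrow> real" where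
  "mid_at P xc xh r = (eval_at P xc r + eval_at P xh r) / 2"

definition secant_slope :: "(real \<Rightarrow> real) \<Rightarrow> real \<Rightarrow> real \<Rightarrow> real" where
  "secant_slope \<phi> vc vh =
     (if vc = vh then deriv \<phi> ((vc + vh) / 2) else (\<phi> vh - \<phi> vc) / (vh - vc))"

fun secant_step ::
    "'n procedure \<Rightarrow> real^'n \<Rightarrow> real^'n \<Rightarrow> real^'n \<Rightarrow> real list \<Rightarrow> 'n address instr \<Rightarrow> real" where
  "secant_step P xc xh dx ds (Const a) = 0"
| "secant_step P xc xh dx ds (Add j k) = lookup dx ds j + lookup dx ds k"
| "secant_step P xc xh dx ds (Sub j k) = lookup dx ds j - lookup dx ds k"
| "secant_step P xc xh dx ds (Mul j k) =
     mid_at P xc xh j * lookup dx ds k + lookup dx ds j * mid_at P xc xh k"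
| "secant_step P xc xh dx ds (Elem \<phi> D j) =
     secant_slope \<phi> (eval_at P xc j) (eval_at P xh j) * lookup dx ds j"
| "secant_step P xc xh dx ds (Abs j) =
     \<bar>mid_at P xc xh j + lookup dx ds j\<bar> - (\<bar>eval_at P xc j\<bar> + \<bar>eval_at P xh j\<bar>) / 2"

definition secant_increment :: "'n procedure \<Rightarrow> real^'n \<Rightarrow> real^'n \<Rightarrow> real^'n \<Rightarrow> real^'n" where
  "secant_increment P xc xh dx =
     (\<chi> i. lookup dx (run (secant_step P xc xh dx) (instrs P)) (outs P i))"

definition secant_lin :: "'n procedure \<Rightarrow> real^'n \<Rightarrow> real^'n \<Rightarrow> real^'n \<Rightarrow> real^'n" where
  "secant_lin P xc xh x =
     (1/2) *\<^sub>R (eval_proc P xc + eval_proc P xh)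
     + secant_increment P xc xh (x - (1/2) *\<^sub>R (xc + xh))"

definition second_order_constant ::
    "(real^'n \<Rightarrow> real) \<Rightarrow> 'n procedure \<Rightarrow> (real^'n \<Rightarrow> real^'n) \<Rightarrow> (real^'n) set \<Rightarrow> real \<Rightarrow> bool" where
  "second_order_constant N P F U \<gamma> \<longleftrightarrow>
     (\<forall>xc\<in>U. \<forall>xh\<in>U. \<forall>x\<in>U.
        N (F x - secant_lin P xc xh x) \<le> 1/2 * \<gamma> * N (x - xh) * N (x - xc)) \<and>
     (\<forall>xo\<in>U. \<forall>x\<in>U.
        N (F x - tangent_lin P xo x) \<le> 1/2 * \<gamma> * (N (x - xo))\<^sup>2) \<and>
     (\<forall>yc\<in>U. \<forall>yh\<in>U. \<forall>zc\<in>U. \<forall>zh\<in>U. \<forall>x.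
        N (secant_lin P zc zh x - secant_lin P yc yh x)
          \<le> \<gamma> * max (N (zh - yh) * max (N (x - yc)) (N (x - zc)))
                    (N (zc - yc) * max (N (x - yh)) (N (x - zh)))) \<and>
     (\<forall>yo\<in>U. \<forall>zo\<in>U. \<forall>x.
        N (tangent_lin P zo x - tangent_lin P yo x)
          \<le> \<gamma> * N (zo - yo) * max (N (x - yo)) (N (x - zo)))"


section \<open>Abs-normal forms\<close>

text \<open>The number \<open>s\<close> of switching variables depends on the procedure and may be zero, so it is
  not a type: vectors in $\mathbb{R}^s$ are functions on \<^typ>\<open>nat\<close> of which only the values below
  \<open>s\<close> matter. \<open>anf_Z A k\<close> is the \<open>k\<close>-th row of \<open>Z\<close>, \<open>anf_Y A k\<close> the \<open>k\<close>-th column of \<open>Y\<close>.\<close>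

record 'n anf =
  anf_s :: nat
  anf_c :: "nat \<Rightarrow> real"
  anf_Z :: "nat \<Rightarrow> real^'n"
  anf_L :: "nat \<Rightarrow> nat \<Rightarrow> real"
  anf_b :: "real^'n"
  anf_J :: "real^'n^'n"
  anf_Y :: "nat \<Rightarrow> real^'n"

definition is_anf :: "('n::finite) anf \<Rightarrow> bool" where
  "is_anf A \<longleftrightarrow> (\<forall>i<anf_s A. \<forall>j<anf_s A. i \<le> j \<longrightarrow> anf_L A i j = 0)"

definition anf_rel :: "('n::finite) anf \<Rightarrow> real^'n \<Rightarrow> (nat \<Rightarrow> real) \<Rightarrow> real^'n \<Rightarrow> bool" where
  "anf_rel A x z y \<longleftrightarrow>
     (\<forall>i<anf_s A. z i = anf_c A i + anf_Z A i \<bullet> x + (\<Sum>j<anf_s A. anf_L A i j * \<bar>z j\<bar>)) \<and>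
     y = anf_b A + anf_J A *v x + (\<Sum>k<anf_s A. \<bar>z k\<bar> *\<^sub>R anf_Y A k)"

text \<open>If \<^term>\<open>is_anf A\<close>, then \<open>z 0, \<dots>, z (s - 1)\<close> and \<open>y\<close> are uniquely determined by \<open>x\<close>.\<close>

definition anf_fun :: "('n::finite) anf \<Rightarrow> real^'n \<Rightarrow> real^'n" where
  "anf_fun A x = (THE y. \<exists>z. anf_rel A x z y)"

fun abs_arg_of :: "'r instr \<Rightarrow> 'r list" where
  "abs_arg_of (Abs r) = [r]"
| "abs_arg_of _ = []"

definition abs_args :: "'r instr list \<Rightarrow> 'r list" where
  "abs_args is = concat (map abs_arg_of is)"

definition abs_count :: "'n procedure \<Rightarrow> nat" where
  "abs_count P = length (abs_args (instrs P))"

definition switching :: "'n procedure \<Rightarrow> real^'n \<Rightarrow> nat \<Rightarrow> real" where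
  "switching P x k = eval_at P x (abs_args (instrs P) ! k)"

text \<open>Abs-free evaluation: the result of the \<open>k\<close>-th absolute value call is replaced by \<open>w k\<close>.
  The number \<open>k\<close> of the current call is the number of calls among the instructions already
  executed.\<close>

fun smooth_step ::
    "'n procedure \<Rightarrow> real^'n \<Rightarrow> (nat \<Rightarrow> real) \<Rightarrow> real list \<Rightarrow> 'n address instr \<Rightarrow> real" where
  "smooth_step P x w vs (Abs j) = w (length (abs_args (take (length vs) (instrs P))))"
| "smooth_step P x w vs ins = eval_step x vs ins"

definition smooth_at :: "'n procedure \<Rightarrow> real^'n \<Rightarrow> (nat \<Rightarrow> real) \<Rightarrow> 'n address \<Rightarrow> real" where
  "smooth_at P x w r = lookup x (run (smooth_step P x w) (instrs P)) r"

definition smooth_G :: "'n procedure \<Rightarrow> real^'n \<Rightarrow> (nat \<Rightarrow> real) \<Rightarrow> nat \<Rightarrow> real" where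
  "smooth_G P x w k = smooth_at P x w (abs_args (instrs P) ! k)"

definition smooth_F :: "'n procedure \<Rightarrow> real^'n \<Rightarrow> (nat \<Rightarrow> real) \<Rightarrow> real^'n" where
  "smooth_F P x w = (\<chi> i. smooth_at P x w (outs P i))"

definition partial_x :: "(real^'n \<Rightarrow> real) \<Rightarrow> real^'n \<Rightarrow> 'n \<Rightarrow> real" where
  "partial_x f x i = deriv (\<lambda>t. f (x + t *\<^sub>R axis i 1)) 0"

definition partial_w :: "((nat \<Rightarrow> real) \<Rightarrow> real) \<Rightarrow> (nat \<Rightarrow> real) \<Rightarrow> nat \<Rightarrow> real" where
  "partial_w f w l = deriv (\<lambda>t. f (w(l := t))) (w l)"

definition tangent_anf :: "('n::finite) procedure \<Rightarrow> real^'n \<Rightarrow> 'n anf" where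
  "tangent_anf P xo =
     (let s = abs_count P;
          w = (\<lambda>k. \<bar>switching P xo k\<bar>);
          Z = (\<lambda>k. \<chi> i. partial_x (\<lambda>x. smooth_G P x w k) xo i);
          L = (\<lambda>k l. partial_w (\<lambda>u. smooth_G P xo u k) w l);
          J = (\<chi> a i. partial_x (\<lambda>x. smooth_F P x w $ a) xo i);
          Y = (\<lambda>l. \<chi> a. partial_w (\<lambda>u. smooth_F P xo u $ a) w l)
      in \<lparr> anf_s = s,
           anf_c = (\<lambda>k. smooth_G P xo w k - Z k \<bullet> xo - (\<Sum>l<s. L k l * w l)),
           anf_Z = Z,
           anf_L = L,
           anf_b = smooth_F P xo w - J *v xo - (\<Sum>l<s. w l *\<^sub>R Y l),
           anf_J = J,
           anf_Y = Y \<rparr>)"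


section \<open>Coherent orientation and stability\<close>

definition coherently_oriented :: "(real^'n \<Rightarrow> real^'n) \<Rightarrow> bool" where
  "coherently_oriented f \<longleftrightarrow>
     (\<exists>\<sigma>\<in>{1, -1}. \<forall>M a U.
        open U \<and> U \<noteq> {} \<and> (\<forall>x\<in>U. f x = M *v x + a) \<longrightarrow> sgn (det M) = \<sigma>)"

text \<open>All norms on the finite-dimensional data spaces are equivalent, so closeness is measured
  entrywise.\<close>

definition stably_Z :: "((real^'n \<Rightarrow> real^'n) \<Rightarrow> bool) \<Rightarrow> ('n::finite) anf \<Rightarrow> bool" where
  "stably_Z Q A \<longleftrightarrow>
     (\<exists>\<epsilon>>0. \<forall>Z'. (\<forall>i<anf_s A. \<forall>j. \<bar>Z' i $ j - anf_Z A i $ j\<bar> < \<epsilon>) \<longrightarrow>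
        Q (anf_fun (A\<lparr>anf_Z := Z'\<rparr>)))"

definition stably_coherently_oriented :: "('n::finite) anf \<Rightarrow> bool" where
  "stably_coherently_oriented A \<longleftrightarrow> stably_Z coherently_oriented A"

definition stably_bijective :: "('n::finite) anf \<Rightarrow> bool" where
  "stably_bijective A \<longleftrightarrow> stably_Z bij A"

definition anf_close :: "real \<Rightarrow> ('n::finite) anf \<Rightarrow> 'n anf \<Rightarrow> bool" where
  "anf_close \<epsilon> A B \<longleftrightarrow>
     anf_s A = anf_s B \<and>
     (\<forall>i<anf_s A.
        \<bar>anf_c A i - anf_c B i\<bar> < \<epsilon> \<and>
        (\<forall>j. \<bar>anf_Z A i $ j - anf_Z B i $ j\<bar> < \<epsilon>) \<and>
        (\<forall>k<anf_s A. \<bar>anf_L A i k - anf_L B i k\<bar> < \<epsilon>) \<and>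
        (\<forall>j. \<bar>anf_Y A i $ j - anf_Y B i $ j\<bar> < \<epsilon>)) \<and>
     (\<forall>i. \<bar>anf_b A $ i - anf_b B $ i\<bar> < \<epsilon>) \<and>
     (\<forall>i j. \<bar>anf_J A $ i $ j - anf_J B $ i $ j\<bar> < \<epsilon>)"

definition under_small_perturbations ::
    "((real^'n \<Rightarrow> real^'n) \<Rightarrow> bool) \<Rightarrow> ('n::finite) anf \<Rightarrow> bool" where
  "under_small_perturbations Q A \<longleftrightarrow>
     (\<exists>\<epsilon>>0. \<forall>B. is_anf B \<and> anf_close \<epsilon> B A \<longrightarrow> Q (anf_fun B))"

definition ave_matrix :: "('n::finite) anf \<Rightarrow> nat \<Rightarrow> nat \<Rightarrow> real" where
  "ave_matrix A i k = anf_L A i k - anf_Z A i \<bullet> (matrix_inv (anf_J A) *v anf_Y A k)"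

text \<open>Uniqueness in $\mathbb{R}^s$: the irrelevant values from \<open>s\<close> on are fixed to be zero.\<close>

definition ave_uniquely_solvable :: "nat \<Rightarrow> (nat \<Rightarrow> nat \<Rightarrow> real) \<Rightarrow> bool" where
  "ave_uniquely_solvable s S \<longleftrightarrow>
     (\<forall>ch. \<exists>!z. (\<forall>i\<ge>s. z i = 0) \<and> (\<forall>i<s. z i - (\<Sum>k<s. S i k * \<bar>z k\<bar>) = ch i))"


section \<open>Newton's methods\<close>

definition tangent_newton_path ::
    "(real^'n \<Rightarrow> real) \<Rightarrow> 'n procedure \<Rightarrow> (nat \<Rightarrow> real^'n) \<Rightarrow> bool" where
  "tangent_newton_path N P X \<longleftrightarrow>
     (\<forall>j. well_defined_at P (X j) \<and>
          is_arg_min (\<lambda>x. N (x - X j)) (\<lambda>x. tangent_lin P (X j) x = 0) (X (Suc j)))"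

definition secant_newton_path ::
    "(real^'n \<Rightarrow> real) \<Rightarrow> 'n procedure \<Rightarrow> (nat \<Rightarrow> real^'n) \<Rightarrow> bool" where
  "secant_newton_path N P X \<longleftrightarrow>
     (\<forall>j. well_defined_at P (X j) \<and>
          is_arg_min (\<lambda>x. N (x - (1/2) *\<^sub>R (X (Suc j) + X j)))
            (\<lambda>x. secant_lin P (X j) (X (Suc j)) x = 0) (X (Suc (Suc j))))"

end

theory Submission
  imports Defs
begin

text \<open>Let \<open>D\<close> range over the cube of sequences with entries in $[-1,1]$. Two values of a linearization
  differ by the value of a linear map, in which every absolute value is replaced by multiplication
  with a difference quotient \<open>D k\<close>. If all these slope maps at \<open>x\<^sup>*\<close> are injective, compactness of the
  cube and continuity of the slopes in the development points give a uniform lower bound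
  $\|\lozenge F(x) - \lozenge F(y)\| \ge c \|x - y\|$ near \<open>x\<^sup>*\<close>, and such a continuous map is bijective by
  invariance of domain.

  Each of the five conditions yields injectivity of the slope maps. If $u - v$ is a
  kernel vector \<open>z\<close> with $|u| - |v| = D z$, then \<open>u\<close> and \<open>v\<close> solve the same absolute value
  equation. If a slope map has a kernel vector \<open>x\<close>, then, as \<open>s \<le> n\<close>, arbitrarily small changes of \<open>Z\<close>
  preserving \<open>Z x\<close> give \<open>Z\<close> full row rank; then every sign vector is attained
  on an open set and every switching vector by some argument. So \<open>u\<close> and \<open>v\<close> refute
  injectivity, and coherent orientation is refuted because the determinant of the slope map is
  affine in each \<open>D k\<close> and has the sign of the vertices of the cube.

  Finally, if \<open>y\<close> is the root of a linearization whose development points have distance at most \<open>m\<close> to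
  \<open>x\<^sup>*\<close>, the Lipschitz estimate for linearizations gives
  $e \le \kappa \gamma m (e + m) \le (e + m)/6$ for the error \<open>e\<close> of \<open>y\<close>, hence $e \le m/5$.\<close>

section \<open>Values of evaluation procedures\<close>

lemma length_run [simp]: "length (run step is) = length is"
  by (induction "is" rule: rev_induct) (auto simp: run_def)

lemma run_snoc: "run step (is @ [i]) = run step is @ [step (run step is) i]"
  by (simp add: run_def)

lemma take_run: "take k (run step is) = run step (take k is)"
proof (induction "is" rule: rev_induct)
  case (snoc i "is")
  show ?case
  proof (cases "k \<le> length is")
    case True
    then show ?thesis by (simp add: run_snoc snoc)
  next
    case False
    then show ?thesis by (simp add: run_snoc)
  qed
qed (simp add: run_def)

text \<open>Later instructions only append, so value \<open>k\<close> is settled by the first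
  \<open>k\<close> values. This locality turns the list semantics into a recursion over
  addresses.\<close>

lemma nth_run:
  assumes "k < length is"
  shows "run step is ! k = step (take k (run step is)) (is ! k)"
proof -
  have "run step is ! k = take (Suc k) (run step is) ! k" by simp
  also have "take (Suc k) (run step is) = run step (take k is @ [is ! k])"
    using assms by (simp only: take_run take_Suc_conv_app_nth)
  also have "\<dots> ! k = step (run step (take k is)) (is ! k)"
    using assms by (simp add: run_snoc nth_append)
  finally show ?thesis by (simp add: take_run)
qed

lemma lookup_take: "available k r \<Longrightarrow> lookup x (take k vs) r = lookup x vs r"
  by (cases r) auto

lemma available_mono: "available k r \<Longrightarrow> k \<le> l \<Longrightarrow> available l r"
  by (cases r) auto

text \<open>If instruction \<open>k\<close> is an absolute value call, this is the number of its
  switching variable. \<open>smooth_step\<close> counts in the same way, with the length of the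
  value list in place of \<open>k\<close>.\<close>

definition abs_index :: "'r instr list \<Rightarrow> nat \<Rightarrow> nat" where
  "abs_index is k = length (abs_args (take k is))"

lemma abs_args_append [simp]: "abs_args (is @ js) = abs_args is @ abs_args js"
  by (simp add: abs_args_def)

lemma abs_index_mono: "k \<le> l \<Longrightarrow> abs_index is k \<le> abs_index is l"
proof -
  assume "k \<le> l"
  then have "take l is = take k is @ take (l - k) (drop k is)"
    by (metis le_add_diff_inverse take_add)
  then show ?thesis by (simp add: abs_index_def)
qed

lemma abs_index_Abs:
  assumes "k < length is" "is ! k = Abs r"
  shows "abs_index is k < length (abs_args is)" "abs_args is ! abs_index is k = r"
    and "abs_index is (Suc k) = Suc (abs_index is k)"
proof -
  have "is = take k is @ Abs r # drop (Suc k) is"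
    using assms by (metis id_take_nth_drop)
  then have "abs_args is = abs_args (take k is @ Abs r # drop (Suc k) is)" by simp
  also have "\<dots> = abs_args (take k is) @ r # abs_args (drop (Suc k) is)"
    by (simp add: abs_args_def)
  finally have *: "abs_args is = abs_args (take k is) @ r # abs_args (drop (Suc k) is)" .
  show "abs_index is k < length (abs_args is)" "abs_args is ! abs_index is k = r"
    by (simp_all add: * abs_index_def)
  show "abs_index is (Suc k) = Suc (abs_index is k)"
    using assms by (simp add: abs_index_def take_Suc_conv_app_nth) (simp add: abs_args_def)
qed

text \<open>Converse of \<open>abs_index_Abs\<close>: it locates the call behind a switching
  variable, as needed for availability and for the triangular shape of \<open>L\<close>.\<close>

lemma abs_args_nth:
  assumes "l < length (abs_args is)"
  shows "\<exists>k<length is. is ! k = Abs (abs_args is ! l) \<and> abs_index is k = l"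
  using assms
proof (induction "is" rule: rev_induct)
  case (snoc i "is")
  show ?case
  proof (cases "l < length (abs_args is)")
    case True
    then obtain k where "k < length is" "is ! k = Abs (abs_args is ! l)" "abs_index is k = l"
      using snoc.IH by blast
    then show ?thesis
      using True by (intro exI[of _ k]) (auto simp: nth_append abs_index_def)
  next
    case False
    with snoc.prems obtain r where "i = Abs r" "l = length (abs_args is)"
      by (cases i) (auto simp: abs_args_def)
    then show ?thesis
      by (intro exI[of _ "length is"]) (auto simp: abs_index_def abs_args_def)
  qed
qed (simp add: abs_args_def)

text \<open>The argument \<open>e k\<close> is the rule for the \<open>k\<close>-th absolute value call. Multiplication with a constant
  gives differences of two secant mode increments, a constant value gives directional derivatives
  of the smooth part.\<close>

fun diff_step :: "'n procedure \<Rightarrow> real^'n \<Rightarrow> real^'n \<Rightarrow> (nat \<Rightarrow> real \<Rightarrow> real) \<Rightarrow> real^'n \<Rightarrow>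
    real list \<Rightarrow> 'n address instr \<Rightarrow> real" where
  "diff_step P xc xh e dx ds (Const a) = 0"
| "diff_step P xc xh e dx ds (Add j k) = lookup dx ds j + lookup dx ds k"
| "diff_step P xc xh e dx ds (Sub j k) = lookup dx ds j - lookup dx ds k"
| "diff_step P xc xh e dx ds (Mul j k) =
     mid_at P xc xh j * lookup dx ds k + lookup dx ds j * mid_at P xc xh k"
| "diff_step P xc xh e dx ds (Elem \<phi> D j) =
     secant_slope \<phi> (eval_at P xc j) (eval_at P xh j) * lookup dx ds j"
| "diff_step P xc xh e dx ds (Abs j) = e (abs_index (instrs P) (length ds)) (lookup dx ds j)"

definition diff_at :: "'n procedure \<Rightarrow> real^'n \<Rightarrow> real^'n \<Rightarrow> (nat \<Rightarrow> real \<Rightarrow> real) \<Rightarrow> real^'n \<Rightarrow>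
    'n address \<Rightarrow> real" where
  "diff_at P xc xh e dx r = lookup dx (run (diff_step P xc xh e dx) (instrs P)) r"

definition secant_at :: "'n procedure \<Rightarrow> real^'n \<Rightarrow> real^'n \<Rightarrow> real^'n \<Rightarrow> 'n address \<Rightarrow> real" where
  "secant_at P xc xh dx r = lookup dx (run (secant_step P xc xh dx) (instrs P)) r"

section \<open>Recursive equations for the values at an address\<close>

lemma procedure_over_available:
  assumes "procedure_over \<Phi> P" "k < length (instrs P)" "r \<in> set_instr (instrs P ! k)"
  shows "available k r"
  using assms by (auto simp: procedure_over_def)

lemma value_Input [simp]:
  "eval_at P x (Input i) = x $ i" "smooth_at P x w (Input i) = x $ i"
  "secant_at P xc xh dx (Input i) = dx $ i" "diff_at P xc xh e dx (Input i) = dx $ i"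
  by (simp_all add: eval_at_def smooth_at_def secant_at_def diff_at_def)

text \<open>The arguments are available at \<open>k\<close>, so reading them among the first
  \<open>k\<close> values already gives their final values. This equation and its three analogues
  replace value lists in most later proofs.\<close>

lemma eval_at_Result:
  assumes "procedure_over \<Phi> P" "k < length (instrs P)"
  shows "eval_at P x (Result k) =
    (case instrs P ! k of
      Const a \<Rightarrow> a
    | Add i j \<Rightarrow> eval_at P x i + eval_at P x j
    | Sub i j \<Rightarrow> eval_at P x i - eval_at P x j
    | Mul i j \<Rightarrow> eval_at P x i * eval_at P x j
    | Elem \<phi> D j \<Rightarrow> \<phi> (eval_at P x j)
    | Abs j \<Rightarrow> \<bar>eval_at P x j\<bar>)"
  using procedure_over_available[OF assms] assms(2)
  by (cases "instrs P ! k") (simp_all add: eval_at_def eval_list_def nth_run lookup_take)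

lemma smooth_at_Result:
  assumes "procedure_over \<Phi> P" "k < length (instrs P)"
  shows "smooth_at P x w (Result k) =
    (case instrs P ! k of
      Const a \<Rightarrow> a
    | Add i j \<Rightarrow> smooth_at P x w i + smooth_at P x w j
    | Sub i j \<Rightarrow> smooth_at P x w i - smooth_at P x w j
    | Mul i j \<Rightarrow> smooth_at P x w i * smooth_at P x w j
    | Elem \<phi> D j \<Rightarrow> \<phi> (smooth_at P x w j)
    | Abs j \<Rightarrow> w (abs_index (instrs P) k))"
  using procedure_over_available[OF assms] assms(2)
  by (cases "instrs P ! k") (simp_all add: smooth_at_def nth_run lookup_take abs_index_def)

lemma secant_at_Result:
  assumes "procedure_over \<Phi> P" "k < length (instrs P)"
  shows "secant_at P xc xh dx (Result k) =
    (case instrs P ! k of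
      Const a \<Rightarrow> 0
    | Add i j \<Rightarrow> secant_at P xc xh dx i + secant_at P xc xh dx j
    | Sub i j \<Rightarrow> secant_at P xc xh dx i - secant_at P xc xh dx j
    | Mul i j \<Rightarrow> mid_at P xc xh i * secant_at P xc xh dx j + secant_at P xc xh dx i * mid_at P xc xh j
    | Elem \<phi> D j \<Rightarrow> secant_slope \<phi> (eval_at P xc j) (eval_at P xh j) * secant_at P xc xh dx j
    | Abs j \<Rightarrow> \<bar>mid_at P xc xh j + secant_at P xc xh dx j\<bar>
        - (\<bar>eval_at P xc j\<bar> + \<bar>eval_at P xh j\<bar>) / 2)"
  using procedure_over_available[OF assms] assms(2)
  by (cases "instrs P ! k") (simp_all add: secant_at_def nth_run lookup_take)

lemma diff_at_Result:
  assumes "procedure_over \<Phi> P" "k < length (instrs P)"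
  shows "diff_at P xc xh e dx (Result k) =
    (case instrs P ! k of
      Const a \<Rightarrow> 0
    | Add i j \<Rightarrow> diff_at P xc xh e dx i + diff_at P xc xh e dx j
    | Sub i j \<Rightarrow> diff_at P xc xh e dx i - diff_at P xc xh e dx j
    | Mul i j \<Rightarrow> mid_at P xc xh i * diff_at P xc xh e dx j + diff_at P xc xh e dx i * mid_at P xc xh j
    | Elem \<phi> D j \<Rightarrow> secant_slope \<phi> (eval_at P xc j) (eval_at P xh j) * diff_at P xc xh e dx j
    | Abs j \<Rightarrow> e (abs_index (instrs P) k) (diff_at P xc xh e dx j))"
  using procedure_over_available[OF assms] assms(2)
  by (cases "instrs P ! k") (simp_all add: diff_at_def nth_run lookup_take)

text \<open>Well-founded induction on the position. The step also provides availability of the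
  arguments, which is needed whenever another fact about them presupposes it.\<close>

lemma address_induct [consumes 2, case_names Input Result]:
  assumes P: "procedure_over \<Phi> P" and r: "available (length (instrs P)) r"
    and Input: "\<And>i. Q (Input i)"
    and Result: "\<And>k. k < length (instrs P) \<Longrightarrow>
      (\<And>r. r \<in> set_instr (instrs P ! k) \<Longrightarrow> Q r \<and> available k r) \<Longrightarrow> Q (Result k)"
  shows "Q r"
proof -
  have "k \<le> length (instrs P) \<Longrightarrow> available k r \<Longrightarrow> Q r" for k r
  proof (induction k arbitrary: r rule: less_induct)
    case (less k)
    show ?case
    proof (cases r)
      case (Result j)
      with less.prems have j: "j < k" "j < length (instrs P)" by auto
      then have "\<And>r. r \<in> set_instr (instrs P ! j) \<Longrightarrow> Q r \<and> available j r"
        using less.IH[of j] procedure_over_available[OF P] by auto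
      with j Result show ?thesis using assms(4) by blast
    qed (simp add: Input)
  qed
  then show ?thesis using r by blast
qed

lemma available_outs: "procedure_over \<Phi> P \<Longrightarrow> available (length (instrs P)) (outs P i)"
  by (simp add: procedure_over_def)

lemma available_abs_args:
  assumes "procedure_over \<Phi> P" "l < abs_count P"
  shows "available (length (instrs P)) (abs_args (instrs P) ! l)"
proof -
  obtain k where k: "k < length (instrs P)" "instrs P ! k = Abs (abs_args (instrs P) ! l)"
    using abs_args_nth assms(2) unfolding abs_count_def by blast
  then have "available k (abs_args (instrs P) ! l)"
    using procedure_over_available[OF assms(1), of k] by simp
  then show ?thesis using k available_mono less_imp_le by blast
qed

text \<open>All rules except the one for \<open>Abs\<close> are linear in the increments, with
  coefficients that depend on the development points alone. In the \<open>Abs\<close> rule the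
  offset cancels, and what remains is the numerator of \<open>D k\<close>.\<close>

lemma secant_at_diff:
  assumes P: "procedure_over \<Phi> P" and r: "available (length (instrs P)) r"
    and D: "D = (\<lambda>k. let a = abs_args (instrs P) ! k; v = secant_at P xc xh dx a;
      u = secant_at P xc xh dy a; m = mid_at P xc xh a in (\<bar>m + v\<bar> - \<bar>m + u\<bar>) / (v - u))"
  shows "secant_at P xc xh dx r - secant_at P xc xh dy r =
    diff_at P xc xh (\<lambda>k v. D k * v) (dx - dy) r"
  using P r
proof (induction r rule: address_induct)
  case (Result k)
  note simps = secant_at_Result[OF P Result(1), of xc xh dx] secant_at_Result[OF P Result(1), of xc xh dy]
    diff_at_Result[OF P Result(1)]
  have IH: "diff_at P xc xh (\<lambda>k v. D k * v) (dx - dy) r =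
      secant_at P xc xh dx r - secant_at P xc xh dy r" if "r \<in> set_instr (instrs P ! k)" for r
    using Result(2)[OF that] by simp
  show ?case
  proof (cases "instrs P ! k")
    case (Abs j)
    define v u m where "v = secant_at P xc xh dx j" and "u = secant_at P xc xh dy j"
      and "m = mid_at P xc xh j"
    have "abs_args (instrs P) ! abs_index (instrs P) k = j"
      by (rule abs_index_Abs(2)[OF Result(1) Abs])
    then have D': "D (abs_index (instrs P) k) = (\<bar>m + v\<bar> - \<bar>m + u\<bar>) / (v - u)"
      by (simp add: D Let_def v_def u_def m_def)
    have "diff_at P xc xh (\<lambda>k v. D k * v) (dx - dy) j = v - u"
      using IH[of j] Abs by (simp add: v_def u_def)
    then have "diff_at P xc xh (\<lambda>k v. D k * v) (dx - dy) (Result k) =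
        (\<bar>m + v\<bar> - \<bar>m + u\<bar>) / (v - u) * (v - u)"
      using Abs D' by (simp add: simps(3))
    \<comment> \<open>For \<open>v = u\<close> the quotient is 0 by the convention for division by
      zero, and the numerator vanishes as well.\<close>
    also have "\<dots> = \<bar>m + v\<bar> - \<bar>m + u\<bar>"
      by (cases "v = u") auto
    finally show ?thesis
      using Abs by (simp add: simps(1,2) v_def u_def m_def)
  next
    case (Elem \<phi> E j)
    then show ?thesis using IH[of j] by (simp add: simps right_diff_distrib)
  next
    case (Mul i j)
    then show ?thesis using IH[of i] IH[of j] by (simp add: simps) (simp add: algebra_simps)
  next
    case (Add i j)
    then show ?thesis using IH[of i] IH[of j] by (simp add: simps)
  next
    case (Sub i j)
    then show ?thesis using IH[of i] IH[of j] by (simp add: simps)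
  qed (simp add: simps)
qed simp

lemma abs_quotient_le: "\<bar>(\<bar>m + v\<bar> - \<bar>m + u\<bar>) / (v - u)\<bar> \<le> (1::real)"
proof (cases "v = u")
  case False
  have "\<bar>\<bar>m + v\<bar> - \<bar>m + u\<bar>\<bar> \<le> \<bar>v - u\<bar>" by arith
  then show ?thesis using False by (simp add: abs_divide)
qed simp

text \<open>Homogeneity allows \<open>dx\<close> to be normalized to unit length in the compactness
  argument.\<close>

lemma diff_at_scaleR:
  assumes "procedure_over \<Phi> P" "available (length (instrs P)) r"
  shows "diff_at P xc xh (\<lambda>k v. D k * v) (c *\<^sub>R dx) r = c * diff_at P xc xh (\<lambda>k v. D k * v) dx r"
  using assms
proof (induction r rule: address_induct)
  case (Result k)
  then show ?case
    by (cases "instrs P ! k") (simp_all add: diff_at_Result[OF assms(1)] algebra_simps)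
qed simp

section \<open>Elemental functions and continuity in the development points\<close>

lemma mid_at_same [simp]: "mid_at P x x = eval_at P x"
  by (simp add: mid_at_def fun_eq_iff)

lemma secant_slope_same [simp]: "secant_slope \<phi> v v = deriv \<phi> v"
  by (simp add: secant_slope_def)

lemma elemental_has_derivative:
  assumes "elemental \<phi> D" "v \<in> D"
  shows "(\<phi> has_real_derivative deriv \<phi> v) (at v)"
  using assms by (auto simp: elemental_def DERIV_deriv_iff_field_differentiable)

lemma elemental_isCont:
  assumes "elemental \<phi> D" "v \<in> D"
  shows "isCont \<phi> v"
  using DERIV_isCont elemental_has_derivative[OF assms] by blast

lemma elemental_isCont_deriv:
  assumes "elemental \<phi> D" "v \<in> D"
  shows "isCont (deriv \<phi>) v"
proof -
  obtain e C where e: "e > 0" "C-lipschitz_on (ball v e \<inter> D) (deriv \<phi>)"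
    using assms by (auto simp: elemental_def)
  have "continuous_on (ball v e \<inter> D) (deriv \<phi>)"
    using e(2) by (rule lipschitz_on_continuous_on)
  moreover have "open (ball v e \<inter> D)" using assms(1) by (auto simp: elemental_def)
  ultimately show ?thesis
    using assms(2) e(1) by (simp add: continuous_on_eq_continuous_at)
qed

text \<open>The mean value theorem. The quotient is symmetric in its two points, so the ordered case
  suffices; for equal points the definition gives the derivative there. Difference quotients and
  derivatives can then be treated alike.\<close>

lemma secant_slope_eq_deriv:
  assumes "elemental \<phi> D" "convex S" "S \<subseteq> D" "a \<in> S" "b \<in> S"
  shows "\<exists>t\<in>S. secant_slope \<phi> a b = deriv \<phi> t"
proof -
  have main: "\<exists>t\<in>S. \<phi> b - \<phi> a = (b - a) * deriv \<phi> t" if "a < b" "a \<in> S" "b \<in> S" for a b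
  proof -
    have sub: "{a..b} \<subseteq> S"
      using that assms(2) closed_segment_subset[of a S b] by (simp add: closed_segment_eq_real_ivl)
    have "\<exists>t>a. t < b \<and> \<phi> b - \<phi> a = (b - a) * deriv \<phi> t"
    proof (rule MVT2[OF that(1)])
      fix t assume "a \<le> t" "t \<le> b"
      with sub assms(3) have "t \<in> D" by auto
      then show "(\<phi> has_real_derivative deriv \<phi> t) (at t)"
        using elemental_has_derivative[OF assms(1)] by blast
    qed
    then obtain t where "a < t" "t < b" "\<phi> b - \<phi> a = (b - a) * deriv \<phi> t" by blast
    with sub show ?thesis by (intro bexI[of _ t]) auto
  qed
  consider "a = b" | "a < b" | "b < a" by linarith
  then show ?thesis
  proof cases
    case 1
    then show ?thesis using assms by auto
  next
    case 2
    then show ?thesis using main[OF 2 assms(4,5)]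
      by (auto simp: secant_slope_def field_simps)
  next
    case 3
    obtain t where "t \<in> S" "\<phi> a - \<phi> b = (a - b) * deriv \<phi> t"
      using main[OF 3 assms(5,4)] by blast
    then show ?thesis using 3
      by (intro bexI[of _ t]) (auto simp: secant_slope_def divide_simps algebra_simps)
  qed
qed

lemma tendsto_secant_slope:
  assumes \<phi>: "elemental \<phi> D" and v: "v \<in> D"
    and f: "(f \<longlongrightarrow> v) Fl" and g: "(g \<longlongrightarrow> v) Fl"
  shows "((\<lambda>a. secant_slope \<phi> (f a) (g a)) \<longlongrightarrow> deriv \<phi> v) Fl"
proof (rule tendstoI)
  fix e :: real assume e: "e > 0"
  obtain d1 where d1: "d1 > 0" "ball v d1 \<subseteq> D"
    using \<phi> v openE[of D v] by (auto simp: elemental_def)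
  obtain d2 where d2: "d2 > 0" "\<And>t. dist t v < d2 \<Longrightarrow> dist (deriv \<phi> t) (deriv \<phi> v) < e"
    using elemental_isCont_deriv[OF \<phi> v] e by (auto simp: continuous_at_eps_delta dist_real_def)
  \<comment> \<open>\<open>d1\<close> keeps the mean value point inside the domain,
    \<open>d2\<close> keeps the derivative there within \<open>e\<close> of its value at
    \<open>v\<close>.\<close>
  define S where "S = ball v (min d1 d2)"
  have S: "convex S" "S \<subseteq> D" using d1 by (auto simp: S_def)
  have "\<forall>\<^sub>F a in Fl. f a \<in> S" "\<forall>\<^sub>F a in Fl. g a \<in> S"
    using tendstoD[OF f, of "min d1 d2"] tendstoD[OF g, of "min d1 d2"] d1 d2
    by (simp_all add: S_def dist_commute)
  then show "\<forall>\<^sub>F a in Fl. dist (secant_slope \<phi> (f a) (g a)) (deriv \<phi> v) < e"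
  proof eventually_elim
    case (elim a)
    then obtain t where "t \<in> S" "secant_slope \<phi> (f a) (g a) = deriv \<phi> t"
      using secant_slope_eq_deriv[OF \<phi> S] by blast
    then show ?case using d2(2)[of t] by (simp add: S_def dist_commute)
  qed
qed

lemma instr_elemental:
  assumes "elemental_library \<Phi>" "procedure_over \<Phi> P" "well_defined_at P x"
    "k < length (instrs P)" "instrs P ! k = Elem \<phi> D j"
  shows "elemental \<phi> D" "eval_at P x j \<in> D"
proof -
  have "Elem \<phi> D j \<in> set (instrs P)" using assms(4,5) by (metis nth_mem)
  then show "elemental \<phi> D" "eval_at P x j \<in> D"
    using assms(1-3) unfolding elemental_library_def procedure_over_def well_defined_at_def by blast+
qed

lemma isCont_eval_at:
  assumes lib: "elemental_library \<Phi>" and P: "procedure_over \<Phi> P"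
    and wd: "well_defined_at P x" and r: "available (length (instrs P)) r"
  shows "isCont (\<lambda>y. eval_at P y r) x"
  using P r
proof (induction r rule: address_induct)
  case (Result k)
  have IH: "isCont (\<lambda>y. eval_at P y r) x" if "r \<in> set_instr (instrs P ! k)" for r
    using Result(2) that by blast
  note simps = eval_at_Result[OF P Result(1)]
  show ?case
  proof (cases "instrs P ! k")
    case (Elem \<phi> D j)
    have "isCont \<phi> (eval_at P x j)"
      using elemental_isCont instr_elemental[OF lib P wd Result(1) Elem] by blast
    then show ?thesis
      using IH[of j] Elem by (simp add: simps) (rule isCont_o2[where g = \<phi>])
  qed (use IH in \<open>auto simp: simps intro!: continuous_intros\<close>)
qed (simp add: continuous_component)

text \<open>The secant slopes tend to derivatives when both development points tend to
  \<open>x\<close>. For \<open>D\<close>, coordinatewise convergence suffices, which is convergence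
  in the product topology.\<close>

lemma tendsto_diff_at:
  assumes lib: "elemental_library \<Phi>" and P: "procedure_over \<Phi> P"
    and wd: "well_defined_at P x" and r: "available (length (instrs P)) r"
    and xc: "(xc \<longlongrightarrow> x) Fl" and xh: "(xh \<longlongrightarrow> x) Fl"
    and D: "\<And>k. ((\<lambda>a. D a k) \<longlongrightarrow> D0 k) Fl" and dx: "(dx \<longlongrightarrow> dx0) Fl"
  shows "((\<lambda>a. diff_at P (xc a) (xh a) (\<lambda>k v. D a k * v) (dx a) r) \<longlongrightarrow>
    diff_at P x x (\<lambda>k v. D0 k * v) dx0 r) Fl"
  using P r
proof (induction r rule: address_induct)
  case (Input i)
  then show ?case using tendsto_vec_nth[OF dx] by simp
next
  case (Result k)
  have IH: "((\<lambda>a. diff_at P (xc a) (xh a) (\<lambda>k v. D a k * v) (dx a) r) \<longlongrightarrow>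
      diff_at P x x (\<lambda>k v. D0 k * v) dx0 r) Fl" if "r \<in> set_instr (instrs P ! k)" for r
    using Result(2) that by blast
  have ev: "((\<lambda>a. eval_at P (xc a) r) \<longlongrightarrow> eval_at P x r) Fl"
    "((\<lambda>a. eval_at P (xh a) r) \<longlongrightarrow> eval_at P x r) Fl" if "r \<in> set_instr (instrs P ! k)" for r
  proof -
    have "available (length (instrs P)) r"
      using Result that available_mono less_imp_le by blast
    then have "isCont (\<lambda>y. eval_at P y r) x" by (rule isCont_eval_at[OF lib P wd])
    then show "((\<lambda>a. eval_at P (xc a) r) \<longlongrightarrow> eval_at P x r) Fl"
      "((\<lambda>a. eval_at P (xh a) r) \<longlongrightarrow> eval_at P x r) Fl"
      using isCont_tendsto_compose xc xh by blast+
  qed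
  have mid: "((\<lambda>a. mid_at P (xc a) (xh a) r) \<longlongrightarrow> eval_at P x r) Fl"
    if "r \<in> set_instr (instrs P ! k)" for r
    using tendsto_divide[OF tendsto_add[OF ev[OF that]] tendsto_const[of 2]]
    by (simp add: mid_at_def)
  note simps = diff_at_Result[OF P Result(1)]
  show ?case
  proof (cases "instrs P ! k")
    case (Elem \<phi> E j)
    have "((\<lambda>a. secant_slope \<phi> (eval_at P (xc a) j) (eval_at P (xh a) j)) \<longlongrightarrow>
        deriv \<phi> (eval_at P x j)) Fl"
      using instr_elemental[OF lib P wd Result(1) Elem] ev[of j] Elem
      by (intro tendsto_secant_slope) auto
    then show ?thesis using IH[of j] Elem by (auto simp: simps intro!: tendsto_mult)
  next
    case (Mul i j)
    then show ?thesis using IH[of i] IH[of j] mid[of i] mid[of j]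
      by (auto simp: simps intro!: tendsto_mult tendsto_add)
  next
    case (Add i j)
    then show ?thesis using IH[of i] IH[of j] by (auto simp: simps intro!: tendsto_add)
  next
    case (Sub i j)
    then show ?thesis using IH[of i] IH[of j] by (auto simp: simps intro!: tendsto_diff)
  next
    case (Abs j)
    then show ?thesis using IH[of j] D by (auto simp: simps intro!: tendsto_mult)
  qed (simp add: simps)
qed

section \<open>The abs-free part and its derivatives\<close>

lemma smooth_at_switching:
  assumes P: "procedure_over \<Phi> P" and r: "available (length (instrs P)) r"
  shows "smooth_at P x (\<lambda>k. \<bar>switching P x k\<bar>) r = eval_at P x r"
  using P r
proof (induction r rule: address_induct)
  case (Result k)
  show ?case
  proof (cases "instrs P ! k")
    case (Abs j)
    then show ?thesis using abs_index_Abs(2)[OF Result(1) Abs]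
      by (simp add: smooth_at_Result[OF P Result(1)] eval_at_Result[OF P Result(1)] switching_def)
  qed (use Result(2) in \<open>simp_all add: smooth_at_Result[OF P Result(1)] eval_at_Result[OF P Result(1)]\<close>)
qed simp

text \<open>The chain rule along a curve. At \<open>t0\<close> the true absolute values are inserted
  and reproduce the values of the procedure, so the coefficients are those of tangent mode; a call
  contributes the prescribed \<open>dw k\<close>. Curves that move a single coordinate yield the
  four blocks of the abs-normal form.\<close>

lemma smooth_at_has_derivative:
  assumes lib: "elemental_library \<Phi>" and P: "procedure_over \<Phi> P"
    and wd: "well_defined_at P x" and r: "available (length (instrs P)) r"
    and X: "X t0 = x" and W: "W t0 = (\<lambda>k. \<bar>switching P x k\<bar>)"
    and dX: "\<And>i. ((\<lambda>t. X t $ i) has_real_derivative dx $ i) (at t0)"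
    and dW: "\<And>k. ((\<lambda>t. W t k) has_real_derivative dw k) (at t0)"
  shows "((\<lambda>t. smooth_at P (X t) (W t) r) has_real_derivative
    diff_at P x x (\<lambda>k v. dw k) dx r) (at t0)"
  using P r
proof (induction r rule: address_induct)
  case (Input i)
  then show ?case using dX by simp
next
  case (Result k)
  have IH: "((\<lambda>t. smooth_at P (X t) (W t) r) has_real_derivative
      diff_at P x x (\<lambda>k v. dw k) dx r) (at t0)" if "r \<in> set_instr (instrs P ! k)" for r
    using Result(2) that by blast
  have val: "smooth_at P (X t0) (W t0) r = eval_at P x r" if "r \<in> set_instr (instrs P ! k)" for r
    unfolding X W using Result that available_mono less_imp_le smooth_at_switching[OF P] by blast
  note simps = diff_at_Result[OF P Result(1)] smooth_at_Result[OF P Result(1)]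
  show ?case
  proof (cases "instrs P ! k")
    case (Elem \<phi> D j)
    have "(\<phi> has_real_derivative deriv \<phi> (eval_at P x j)) (at (smooth_at P (X t0) (W t0) j))"
      using elemental_has_derivative instr_elemental[OF lib P wd Result(1) Elem] val[of j] Elem by simp
    then show ?thesis
      using DERIV_chain2[OF _ IH[of j]] Elem by (simp add: simps)
  next
    case (Mul i j)
    then show ?thesis using DERIV_mult[OF IH[of i] IH[of j]] val[of i] val[of j]
      by (simp add: simps algebra_simps)
  next
    case (Add i j)
    then show ?thesis using IH[of i] IH[of j] by (auto simp: simps intro!: DERIV_add)
  next
    case (Sub i j)
    then show ?thesis using IH[of i] IH[of j] by (auto simp: simps intro!: DERIV_diff)
  next
    case (Abs j)
    then show ?thesis using dW by (simp add: simps)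
  qed (simp add: simps)
qed

text \<open>Superposition: with a constant rule at the calls the result is linear in
  \<open>dx\<close> and \<open>dw\<close> jointly, hence a combination of the results for unit
  vectors. Those are the entries of \<open>Z\<close>, \<open>L\<close>, \<open>J\<close> and
  \<open>Y\<close>.\<close>

lemma diff_at_linear_sum:
  fixes P :: "'n::finite procedure"
  assumes P: "procedure_over \<Phi> P" and r: "available (length (instrs P)) r"
  shows "diff_at P x x (\<lambda>k v. dw k) dx r =
    (\<Sum>i\<in>UNIV. dx $ i * diff_at P x x (\<lambda>k v. 0) (axis i 1) r) +
    (\<Sum>l<abs_count P. dw l * diff_at P x x (\<lambda>k v. if k = l then 1 else 0) 0 r)"
  using P r
proof (induction r rule: address_induct)
  case (Input i)
  have "(\<Sum>j\<in>UNIV. dx $ j * (axis j 1 :: real^'n) $ i) = (\<Sum>j\<in>UNIV. if j = i then dx $ i else 0)"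
    by (intro sum.cong) (auto simp: axis_def)
  then show ?case by simp
next
  case (Result k)
  note simps = diff_at_Result[OF P Result(1)]
  show ?case
  proof (cases "instrs P ! k")
    case (Abs j)
    have "abs_index (instrs P) k < abs_count P"
      using abs_index_Abs(1)[OF Result(1) Abs] by (simp add: abs_count_def)
    then have "(\<Sum>l<abs_count P. dw l * (if abs_index (instrs P) k = l then 1 else 0)) =
        dw (abs_index (instrs P) k)"
      by (subst sum.mono_neutral_right[of _ "{abs_index (instrs P) k}"]) auto
    then show ?thesis using Abs by (simp add: simps)
  next
    case (Mul i j)
    have "diff_at P x x (\<lambda>k v. dw k) dx (Result k) =
      eval_at P x i * diff_at P x x (\<lambda>k v. dw k) dx j + diff_at P x x (\<lambda>k v. dw k) dx i * eval_at P x j"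
      using Mul by (simp add: simps)
    also have "\<dots> = eval_at P x i * ((\<Sum>i\<in>UNIV. dx $ i * diff_at P x x (\<lambda>k v. 0) (axis i 1) j) +
      (\<Sum>l<abs_count P. dw l * diff_at P x x (\<lambda>k v. if k = l then 1 else 0) 0 j)) +
      ((\<Sum>j\<in>UNIV. dx $ j * diff_at P x x (\<lambda>k v. 0) (axis j 1) i) +
      (\<Sum>l<abs_count P. dw l * diff_at P x x (\<lambda>k v. if k = l then 1 else 0) 0 i)) * eval_at P x j"
      using Result(2)[of i] Result(2)[of j] Mul by simp
    finally show ?thesis using Mul
      by (simp add: simps sum_distrib_left sum_distrib_right sum.distrib algebra_simps)
  next
    case (Elem \<phi> D j)
    then show ?thesis using Result(2)[of j]
      by (simp add: simps sum_distrib_left distrib_left mult.left_commute)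
  next
    case (Add i j)
    then show ?thesis using Result(2)[of i] Result(2)[of j]
      by (simp add: simps sum.distrib distrib_left)
  next
    case (Sub i j)
    then show ?thesis using Result(2)[of i] Result(2)[of j]
      by (simp add: simps sum_subtractf right_diff_distrib)
  qed (simp add: simps)
qed

text \<open>Freezing the value \<open>D k * v\<close> that occurs at call \<open>k\<close> turns
  multiplication into a constant rule, so that superposition applies.\<close>

lemma diff_at_slope:
  assumes P: "procedure_over \<Phi> P" and r: "available (length (instrs P)) r"
    and dw: "dw = (\<lambda>k. D k * diff_at P xc xh (\<lambda>k v. D k * v) dx (abs_args (instrs P) ! k))"
  shows "diff_at P xc xh (\<lambda>k v. D k * v) dx r = diff_at P xc xh (\<lambda>k v. dw k) dx r"
  using P r
proof (induction r rule: address_induct)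
  case (Result k)
  note simps = diff_at_Result[OF P Result(1)]
  show ?case
  proof (cases "instrs P ! k")
    case (Abs j)
    then show ?thesis using abs_index_Abs(2)[OF Result(1) Abs] by (simp add: simps dw)
  qed (use Result(2) in \<open>simp_all add: simps\<close>)
qed simp

text \<open>Causality: a value computed before call \<open>l\<close> cannot react to the result of
  that call. Applied to the arguments of calls, this makes \<open>L\<close> strictly lower
  triangular.\<close>

lemma diff_at_later_abs:
  assumes P: "procedure_over \<Phi> P" and r: "available p r" and p: "p \<le> length (instrs P)"
    and l: "abs_index (instrs P) p \<le> l"
  shows "diff_at P x x (\<lambda>k v. if k = l then 1 else 0) 0 r = 0"
proof -
  have "available (length (instrs P)) r" using r p available_mono by blast
  with P show ?thesis using r p l
  proof (induction r arbitrary: p rule: address_induct)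
    case (Result k)
    then have k: "k < p" by simp
    have IH: "diff_at P x x (\<lambda>k v. if k = l then 1 else 0) 0 r = 0"
      if "r \<in> set_instr (instrs P ! k)" for r
      using Result(2)[OF that] Result(4,5) k available_mono less_imp_le by blast
    note simps = diff_at_Result[OF P Result(1)]
    show ?case
    proof (cases "instrs P ! k")
      case (Abs j)
      \<comment> \<open>Counting up to \<open>Suc k\<close> includes instruction \<open>k\<close>
        itself, which makes its call number strictly smaller than \<open>l\<close>.\<close>
      have "abs_index (instrs P) (Suc k) \<le> abs_index (instrs P) p"
        using k by (intro abs_index_mono) simp
      then have "abs_index (instrs P) k \<noteq> l"
        using abs_index_Abs(3)[OF Result(1) Abs] Result(5) by simp
      then show ?thesis using Abs by (simp add: simps)
    qed (simp_all add: simps IH)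
  qed simp
qed

section \<open>Slopes of abs-normal forms\<close>

text \<open>Injectivity of all slope maps: \<open>D k\<close> stands for a difference quotient of the \<open>k\<close>-th absolute
  value.\<close>

definition slope_regular :: "('n::finite) anf \<Rightarrow> bool" where
  "slope_regular A \<longleftrightarrow>
     (\<forall>D x z. (\<forall>k. \<bar>D k\<bar> \<le> 1) \<and>
        (\<forall>i<anf_s A. z i = anf_Z A i \<bullet> x + (\<Sum>j<anf_s A. anf_L A i j * (D j * z j))) \<and>
        anf_J A *v x + (\<Sum>k<anf_s A. (D k * z k) *\<^sub>R anf_Y A k) = 0 \<longrightarrow> x = 0)"


text \<open>Stated as surjectivity of \<open>Z\<close>, because it serves to prescribe switching
  vectors.\<close>

definition full_row_rank :: "('n::finite) anf \<Rightarrow> bool" where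
  "full_row_rank A \<longleftrightarrow> (\<forall>h. \<exists>x. \<forall>i<anf_s A. anf_Z A i \<bullet> x = h i)"

section \<open>Switching vectors by forward substitution\<close>

lemma sum_strict_lower:
  assumes "is_anf A" "i < anf_s A"
  shows "(\<Sum>j<anf_s A. anf_L A i j * f j) = (\<Sum>j<i. anf_L A i j * f j)"
  using assms by (intro sum.mono_neutral_right) (auto simp: is_anf_def)

text \<open>Induction along the strictly triangular system. The function \<open>g\<close> is
  \<open>abs\<close> for the abs-normal form itself and multiplication by \<open>D j\<close> for its
  slopes.\<close>

lemma anf_switching_unique:
  assumes A: "is_anf A"
    and z: "\<And>i. i < anf_s A \<Longrightarrow> z i = h i + (\<Sum>j<anf_s A. anf_L A i j * g j (z j))"
    and z': "\<And>i. i < anf_s A \<Longrightarrow> z' i = h i + (\<Sum>j<anf_s A. anf_L A i j * g j (z' j))"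
    and i: "i < anf_s A"
  shows "z i = z' i"
  using i
proof (induction i rule: less_induct)
  case (less i)
  have "(\<Sum>j<i. anf_L A i j * g j (z j)) = (\<Sum>j<i. anf_L A i j * g j (z' j))"
    using less by (intro sum.cong) auto
  then show ?case
    using z[OF less.prems] z'[OF less.prems] sum_strict_lower[OF A less.prems] by simp
qed

lemma anf_fun_eqI:
  assumes A: "is_anf A" and y: "anf_rel A x z y"
  shows "anf_fun A x = y"
  unfolding anf_fun_def
proof (rule the_equality)
  show "\<exists>z. anf_rel A x z y" using y by blast
next
  fix y' assume "\<exists>z. anf_rel A x z y'"
  then obtain z' where y': "anf_rel A x z' y'" by blast
  have "z' i = z i" if "i < anf_s A" for i
  proof (rule anf_switching_unique[OF A _ _ that, where h = "\<lambda>i. anf_c A i + anf_Z A i \<bullet> x" and g = "\<lambda>j. abs"])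
    show "z i = anf_c A i + anf_Z A i \<bullet> x + (\<Sum>j<anf_s A. anf_L A i j * \<bar>z j\<bar>)" if "i < anf_s A" for i
      using y that unfolding anf_rel_def by blast
    show "z' i = anf_c A i + anf_Z A i \<bullet> x + (\<Sum>j<anf_s A. anf_L A i j * \<bar>z' j\<bar>)" if "i < anf_s A" for i
      using y' that unfolding anf_rel_def by blast
  qed
  moreover have "y = anf_b A + anf_J A *v x + (\<Sum>k<anf_s A. \<bar>z k\<bar> *\<^sub>R anf_Y A k)"
    "y' = anf_b A + anf_J A *v x + (\<Sum>k<anf_s A. \<bar>z' k\<bar> *\<^sub>R anf_Y A k)"
    using y y' unfolding anf_rel_def by blast+
  ultimately show "y' = y" by simp
qed

text \<open>Place \<open>u k\<close> and \<open>v k\<close> on opposite sides of 0, so that their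
  absolute values add up to that of \<open>z k\<close>. The position of 0 between them then adjusts
  the difference of the absolute values to any \<open>D k * z k\<close>.\<close>

lemma abs_difference_quotient_attained:
  assumes "\<And>k. \<bar>D k\<bar> \<le> (1::real)"
  obtains u v :: "nat \<Rightarrow> real" where "\<And>k. u k - v k = z k" "\<And>k. \<bar>u k\<bar> - \<bar>v k\<bar> = D k * z k"
proof
  fix k
  define u where "u k = (if z k \<ge> 0 then (1 + D k) * z k / 2 else (1 - D k) * z k / 2)" for k
  define v where "v k = u k - z k" for k
  show "u k - v k = z k" by (simp add: v_def)
  have D: "0 \<le> 1 + D k" "0 \<le> 1 - D k" using assms[of k] by (auto simp: abs_le_iff)
  show "\<bar>u k\<bar> - \<bar>v k\<bar> = D k * z k"
  proof (cases "z k \<ge> 0")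
    case True
    have v: "v k = - ((1 - D k) * z k / 2)" using True by (simp add: v_def u_def field_simps)
    have "\<bar>u k\<bar> = (1 + D k) * z k / 2" using True D by (simp add: u_def abs_mult)
    moreover have "\<bar>v k\<bar> = (1 - D k) * z k / 2" using True D unfolding v by (simp add: abs_mult)
    ultimately show ?thesis by (simp add: field_simps)
  next
    case False
    have v: "v k = - ((1 + D k) * z k / 2)" using False by (simp add: v_def u_def field_simps)
    have "\<bar>u k\<bar> = - ((1 - D k) * z k / 2)" using False D by (simp add: u_def abs_mult)
    moreover have "\<bar>v k\<bar> = - ((1 + D k) * z k / 2)" using False D unfolding v by (simp add: abs_mult)
    ultimately show ?thesis by (simp add: field_simps)
  qed
qed

text \<open>Full row rank provides an argument \<open>a\<close> with switching vector
  \<open>u\<close>. Then \<open>a - x\<close> has switching vector \<open>v\<close> and the same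
  value, because the equations at the two points differ exactly by the kernel equations.\<close>

lemma slope_regular_if_inj:
  assumes A: "is_anf A" and rank: "full_row_rank A" and inj: "inj (anf_fun A)"
  shows "slope_regular A"
  unfolding slope_regular_def
proof (intro allI impI, elim conjE)
  fix D x z
  assume D: "\<forall>k. \<bar>D k\<bar> \<le> 1"
    and z: "\<forall>i<anf_s A. z i = anf_Z A i \<bullet> x + (\<Sum>j<anf_s A. anf_L A i j * (D j * z j))"
    and 0: "anf_J A *v x + (\<Sum>k<anf_s A. (D k * z k) *\<^sub>R anf_Y A k) = 0"
  obtain u v where uv: "\<And>k. u k - v k = z k" "\<And>k. \<bar>u k\<bar> - \<bar>v k\<bar> = D k * z k"
    using abs_difference_quotient_attained[of D z] D by blast
  obtain a where a: "\<forall>i<anf_s A. anf_Z A i \<bullet> a = u i - anf_c A i - (\<Sum>j<anf_s A. anf_L A i j * \<bar>u j\<bar>)"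
    using rank[unfolded full_row_rank_def, rule_format,
        of "\<lambda>i. u i - anf_c A i - (\<Sum>j<anf_s A. anf_L A i j * \<bar>u j\<bar>)"] by blast
  define y where "y = anf_b A + anf_J A *v a + (\<Sum>k<anf_s A. \<bar>u k\<bar> *\<^sub>R anf_Y A k)"
  have "anf_rel A a u y" using a by (simp add: anf_rel_def y_def)
  moreover have "anf_rel A (a - x) v y"
    unfolding anf_rel_def
  proof (intro conjI allI impI)
    fix i assume i: "i < anf_s A"
    have "(\<Sum>j<anf_s A. anf_L A i j * \<bar>v j\<bar>) =
        (\<Sum>j<anf_s A. anf_L A i j * \<bar>u j\<bar>) - (\<Sum>j<anf_s A. anf_L A i j * (D j * z j))"
      by (simp add: right_diff_distrib flip: uv(2) sum_subtractf)
    then show "v i = anf_c A i + anf_Z A i \<bullet> (a - x) + (\<Sum>j<anf_s A. anf_L A i j * \<bar>v j\<bar>)"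
      using a[rule_format, OF i] z[rule_format, OF i] uv(1)[of i] by (simp add: inner_diff_right)
  next
    have "(\<Sum>k<anf_s A. \<bar>v k\<bar> *\<^sub>R anf_Y A k) =
        (\<Sum>k<anf_s A. \<bar>u k\<bar> *\<^sub>R anf_Y A k) - (\<Sum>k<anf_s A. (D k * z k) *\<^sub>R anf_Y A k)"
      by (simp add: scaleR_left_diff_distrib flip: uv(2) sum_subtractf)
    also have "(\<Sum>k<anf_s A. (D k * z k) *\<^sub>R anf_Y A k) = - (anf_J A *v x)"
      using 0 by (simp add: eq_neg_iff_add_eq_0 add.commute)
    finally show "y = anf_b A + anf_J A *v (a - x) + (\<Sum>k<anf_s A. \<bar>v k\<bar> *\<^sub>R anf_Y A k)"
      by (simp add: y_def matrix_vector_mult_diff_distrib)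
  qed
  ultimately have "anf_fun A a = anf_fun A (a - x)" using anf_fun_eqI[OF A] by metis
  then have "a = a - x" using inj by (rule injD[rotated])
  then show "x = 0" by simp
qed

text \<open>Solving the output equation for \<open>x\<close> with the inverse of \<open>J\<close>
  leaves \<open>z = S (D z)\<close>. Hence \<open>u\<close> and \<open>v\<close> solve the absolute
  value equation with the same right-hand side, so \<open>z = 0\<close> and then
  \<open>J x = 0\<close>.\<close>

lemma slope_regular_if_ave_uniquely_solvable:
  assumes J: "invertible (anf_J A)" and ave: "ave_uniquely_solvable (anf_s A) (ave_matrix A)"
  shows "slope_regular A"
  unfolding slope_regular_def
proof (intro allI impI, elim conjE)
  fix D x z
  assume D: "\<forall>k. \<bar>D k\<bar> \<le> 1"
    and z: "\<forall>i<anf_s A. z i = anf_Z A i \<bullet> x + (\<Sum>j<anf_s A. anf_L A i j * (D j * z j))"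
    and 0: "anf_J A *v x + (\<Sum>k<anf_s A. (D k * z k) *\<^sub>R anf_Y A k) = 0"
  let ?s = "anf_s A" and ?S = "ave_matrix A" and ?J = "anf_J A"
  \<comment> \<open>\<open>matrix_inv\<close> is a choice among two-sided inverses; invertibility
    guarantees that there is one.\<close>
  have "matrix_inv ?J ** ?J = mat 1"
    using someI_ex[OF J[unfolded invertible_def]] by (simp add: matrix_inv_def)
  then have inv: "matrix_inv ?J *v (?J *v y) = y" for y
    by (simp add: matrix_vector_mul_assoc)
  have x: "(\<Sum>k<?s. (D k * z k) *\<^sub>R (matrix_inv ?J *v anf_Y A k)) = - x"
  proof -
    have "(\<Sum>k<?s. (D k * z k) *\<^sub>R (matrix_inv ?J *v anf_Y A k)) =
        matrix_inv ?J *v (\<Sum>k<?s. (D k * z k) *\<^sub>R anf_Y A k)"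
      by (simp add: linear_sum[OF matrix_vector_mul_linear] matrix_vector_mult_scaleR)
    also have "(\<Sum>k<?s. (D k * z k) *\<^sub>R anf_Y A k) = ?J *v (- x)"
      using 0 by (simp add: eq_neg_iff_add_eq_0 add.commute linear_neg[OF matrix_vector_mul_linear])
    finally show ?thesis by (simp add: inv)
  qed
  have zS: "z i = (\<Sum>k<?s. ?S i k * (D k * z k))" if "i < ?s" for i
  proof -
    have "(\<Sum>k<?s. ?S i k * (D k * z k)) = (\<Sum>k<?s. anf_L A i k * (D k * z k)) -
        anf_Z A i \<bullet> (\<Sum>k<?s. (D k * z k) *\<^sub>R (matrix_inv ?J *v anf_Y A k))"
      by (simp add: ave_matrix_def inner_sum_right flip: sum_subtractf) (simp add: algebra_simps)
    then show ?thesis using z[rule_format, OF that] by (simp add: x)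
  qed
  obtain u v where uv: "\<And>k. u k - v k = z k" "\<And>k. \<bar>u k\<bar> - \<bar>v k\<bar> = D k * z k"
    using abs_difference_quotient_attained[of D z] D by blast
  \<comment> \<open>Unique solvability speaks of sequences that vanish from \<open>s\<close> on, so
    \<open>u\<close> and \<open>v\<close> are cut off there.\<close>
  define u' where "u' i = (if i < ?s then u i else 0)" for i
  define v' where "v' i = (if i < ?s then v i else 0)" for i
  define ch where "ch i = u' i - (\<Sum>k<?s. ?S i k * \<bar>u' k\<bar>)" for i
  have "v' i - (\<Sum>k<?s. ?S i k * \<bar>v' k\<bar>) = ch i" if "i < ?s" for i
  proof -
    have "(\<Sum>k<?s. ?S i k * (D k * z k)) = (\<Sum>k<?s. ?S i k * \<bar>u' k\<bar>) - (\<Sum>k<?s. ?S i k * \<bar>v' k\<bar>)"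
      unfolding sum_subtractf[symmetric]
      by (intro sum.cong) (auto simp: u'_def v'_def right_diff_distrib simp flip: uv(2))
    then show ?thesis using zS[OF that] uv(1)[of i] that by (simp add: ch_def u'_def v'_def)
  qed
  then have "u' = v'"
    using ave[unfolded ave_uniquely_solvable_def, rule_format, of ch]
    by (elim ex1E) (metis ch_def u'_def v'_def not_le)
  then have "z i = 0" if "i < ?s" for i
    using that uv(1)[of i] by (metis u'_def v'_def diff_self)
  then have "?J *v x = 0" using 0 by simp
  then show "x = 0" using inv[of x] by simp
qed

text \<open>For strictly lower triangular \<open>L\<close> this is the solution
  \<open>(I - L D)^(-1) h\<close> of \<open>z = h + L D z\<close>, with \<open>D\<close> read as a
  diagonal matrix. Its equation is taken from the simplifier because the right-hand side could be
  unfolded again and again.\<close>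

fun tri :: "(nat \<Rightarrow> nat \<Rightarrow> real) \<Rightarrow> (nat \<Rightarrow> real) \<Rightarrow> (nat \<Rightarrow> real) \<Rightarrow> nat \<Rightarrow> real" where
  "tri L D h i = h i + (\<Sum>j<i. L i j * (D j * tri L D h j))"

declare tri.simps [simp del]

lemma tri_add: "tri L D (\<lambda>i. h i + h' i) i = tri L D h i + tri L D h' i"
proof (induction i rule: less_induct)
  case (less i)
  then have "(\<Sum>j<i. L i j * (D j * tri L D (\<lambda>i. h i + h' i) j)) =
      (\<Sum>j<i. L i j * (D j * tri L D h j) + L i j * (D j * tri L D h' j))"
    by (intro sum.cong) (auto simp: distrib_left)
  then show ?case by (simp add: tri.simps[of _ _ _ i] sum.distrib)
qed

lemma tri_mult: "tri L D (\<lambda>i. c * h i) i = c * tri L D h i"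
proof (induction i rule: less_induct)
  case (less i)
  then have "(\<Sum>j<i. L i j * (D j * tri L D (\<lambda>i. c * h i) j)) =
      (\<Sum>j<i. c * (L i j * (D j * tri L D h j)))"
    by (intro sum.cong) auto
  then show ?case by (simp add: tri.simps[of _ _ _ i] sum_distrib_left distrib_left)
qed

lemma continuous_on_tri:
  assumes "\<And>i. continuous_on S (\<lambda>x. h x i)"
  shows "continuous_on S (\<lambda>x. tri L D (h x) i)"
proof (induction i rule: less_induct)
  case (less i)
  show ?case unfolding tri.simps[of _ _ _ i]
    by (intro continuous_intros assms less) auto
qed

lemma tri_eqI:
  assumes "is_anf A" "\<And>i. i < anf_s A \<Longrightarrow> z i = h i + (\<Sum>j<anf_s A. anf_L A i j * (D j * z j))"
    "i < anf_s A"
  shows "z i = tri (anf_L A) D h i"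
proof (rule anf_switching_unique[OF assms(1), where h = h and g = "\<lambda>j t. D j * t"])
  show "z i = h i + (\<Sum>j<anf_s A. anf_L A i j * (D j * z j))" if "i < anf_s A" for i
    using that by (rule assms(2))
  fix i assume "i < anf_s A"
  then show "tri (anf_L A) D h i = h i + (\<Sum>j<anf_s A. anf_L A i j * (D j * tri (anf_L A) D h j))"
    using sum_strict_lower[OF assms(1)] by (subst tri.simps) simp
qed (rule assms(3))

lemma tri_eq_0: "(\<And>i. i \<le> k \<Longrightarrow> h i = 0) \<Longrightarrow> tri L D h k = 0"
proof (induction k rule: less_induct)
  case (less k)
  then show ?case by (simp add: tri.simps[of _ _ _ k])
qed

text \<open>Changing one entry of \<open>D\<close> is a rank-one update, because the strict triangularity of \<open>L\<close>
  makes component \<open>k\<close> independent of \<open>D k\<close>.\<close>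

lemma tri_upd:
  assumes L: "\<And>i. i \<le> k \<Longrightarrow> L i k = 0" and Dk: "D k = 0"
  shows "tri L (D(k := t)) h i = tri L D h i + t * tri L D h k * tri L D (\<lambda>i. L i k) i"
proof (induction i rule: less_induct)
  case (less i)
  let ?r = "tri L D (\<lambda>i. L i k)"
  \<comment> \<open>Since component \<open>k\<close> of \<open>?r\<close> vanishes, the update
    leaves component \<open>k\<close> of the solution unchanged. Hence the summand for
    \<open>j = k\<close> is linear in \<open>t\<close>.\<close>
  have r0: "?r k = 0" using L by (rule tri_eq_0)
  have "(\<Sum>j<i. L i j * ((D(k := t)) j * tri L (D(k := t)) h j)) =
      (\<Sum>j<i. L i j * (D j * tri L D h j) + t * tri L D h k * (L i j * (D j * ?r j)) +
        (if j = k then t * tri L D h k * L i k else 0))"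
  proof (intro sum.cong refl)
    fix j assume "j \<in> {..<i}"
    then show "L i j * ((D(k := t)) j * tri L (D(k := t)) h j) =
      L i j * (D j * tri L D h j) + t * tri L D h k * (L i j * (D j * ?r j)) +
      (if j = k then t * tri L D h k * L i k else 0)"
      using less.IH[of j] Dk r0
      by (cases "j = k") (simp_all add: algebra_simps del: fun_upd_apply, simp_all add: algebra_simps)
  qed
  also have "\<dots> = (\<Sum>j<i. L i j * (D j * tri L D h j)) +
      t * tri L D h k * ((\<Sum>j<i. L i j * (D j * ?r j)) + L i k)"
  proof -
    have "(\<Sum>j<i. if j = k then t * tri L D h k * L i k else 0) = t * tri L D h k * L i k"
      using L[of i] by (cases "k < i") auto
    then show ?thesis by (simp add: sum.distrib distrib_left flip: sum_distrib_left)
  qed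
  finally show ?case
    by (simp add: tri.simps[of _ _ _ i] add.commute del: fun_upd_apply)
qed

text \<open>An orthogonal matrix maps \<open>p\<close> onto a coordinate axis. Afterwards
  \<open>t\<close> enters a single row, in which the determinant is linear.\<close>

lemma det_rank_one_affine:
  fixes A :: "real^'n^'n"
  shows "\<exists>\<alpha> \<beta>. \<forall>t. det (A + t *\<^sub>R (\<chi> i j. p $ i * q $ j)) = \<alpha> + \<beta> * t"
proof (cases "p = 0")
  case True
  then have "(\<chi> i j. p $ i * q $ j) = (0 :: real^'n^'n)" by (simp add: vec_eq_iff)
  then show ?thesis by (intro exI[of _ "det A"] exI[of _ 0]) simp
next
  case False
  \<comment> \<open>The choice of the coordinate is arbitrary.\<close>
  define k :: 'n where "k = undefined"
  obtain C :: "real^'n^'n" where C: "orthogonal_matrix C" "C *v axis k 1 = (1 / norm p) *\<^sub>R p"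
    using orthogonal_matrix_exists_basis[of "(1 / norm p) *\<^sub>R p" k] False by auto
  define B where "B = transpose C"
  have B: "orthogonal_matrix B" using C(1) by (simp add: B_def orthogonal_matrix_transpose)
  have "p = norm p *\<^sub>R (C *v axis k 1)" using C(2) False by simp
  then have "B *v p = norm p *\<^sub>R (B *v (C *v axis k 1))"
    by (metis matrix_vector_mult_scaleR)
  also have "B *v (C *v axis k 1) = axis k 1"
    using C(1) by (simp add: B_def matrix_vector_mul_assoc orthogonal_matrix_def)
  finally have Bp: "(\<Sum>l\<in>UNIV. B $ i $ l * p $ l) = (if i = k then norm p else 0)" for i
    by (simp add: vec_eq_iff matrix_vector_mult_def axis_def)
  define a where "a = (B ** A)"
  have "B ** (A + t *\<^sub>R (\<chi> i j. p $ i * q $ j)) =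
      (\<chi> i. if i = k then a $ i + (t * norm p) *s q else a $ i)" for t
  proof -
    have "(\<Sum>l\<in>UNIV. B $ i $ l * (A $ l $ j + t * (p $ l * q $ j))) =
        a $ i $ j + t * (\<Sum>l\<in>UNIV. B $ i $ l * p $ l) * q $ j" for i j
      by (simp add: a_def matrix_matrix_mult_def distrib_left sum.distrib sum_distrib_left
          sum_distrib_right mult_ac)
    then show ?thesis
      by (simp add: vec_eq_iff matrix_matrix_mult_def Bp)
  qed
  then have main: "det B * det (A + t *\<^sub>R (\<chi> i j. p $ i * q $ j)) =
      det (\<chi> i. if i = k then a $ i else a $ i) + t * norm p * det (\<chi> i. if i = k then q else a $ i)" for t
    by (simp only: det_mul[symmetric] det_row_add det_row_mul)
  \<comment> \<open>The determinant of \<open>B\<close> is 1 or -1, so multiplying by it once more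
    removes it.\<close>
  have BB: "det B * det B = 1" using det_orthogonal_matrix[OF B] by auto
  have "det (A + t *\<^sub>R (\<chi> i j. p $ i * q $ j)) =
      det B * det (\<chi> i. if i = k then a $ i else a $ i) +
      (det B * norm p * det (\<chi> i. if i = k then q else a $ i)) * t" for t
  proof -
    have "det (A + t *\<^sub>R (\<chi> i j. p $ i * q $ j)) =
        det B * (det B * det (A + t *\<^sub>R (\<chi> i j. p $ i * q $ j)))"
      by (simp only: mult.assoc[symmetric] BB mult_1)
    then show ?thesis unfolding main by (simp only: distrib_left mult_ac)
  qed
  then show ?thesis by blast
qed

text \<open>The matrix \<open>J + Y D (I - L D)^(-1) Z\<close>.\<close>

definition slope_matrix :: "('n::finite) anf \<Rightarrow> (nat \<Rightarrow> real) \<Rightarrow> real^'n^'n" where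
  "slope_matrix A D = matrix (\<lambda>x. anf_J A *v x +
     (\<Sum>k<anf_s A. (D k * tri (anf_L A) D (\<lambda>i. anf_Z A i \<bullet> x) k) *\<^sub>R anf_Y A k))"

lemma slope_matrix_works:
  "slope_matrix A D *v x = anf_J A *v x +
     (\<Sum>k<anf_s A. (D k * tri (anf_L A) D (\<lambda>i. anf_Z A i \<bullet> x) k) *\<^sub>R anf_Y A k)"
  unfolding slope_matrix_def
  by (rule fun_cong[OF matrix_vector_mul(2)], rule linearI)
     (simp_all add: matrix_vector_right_distrib inner_add_right tri_add tri_mult distrib_left
       scaleR_left_distrib sum.distrib matrix_vector_mult_scaleR scaleR_sum_right scaleR_add_right
       mult.left_commute linear_cmul[OF matrix_vector_mul_linear])

lemma det_slope_matrix_affine: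
  assumes A: "is_anf A" and k: "k < anf_s A"
  shows "\<exists>\<alpha> \<beta>. \<forall>t. det (slope_matrix A (D(k := t))) = \<alpha> + \<beta> * t"
proof -
  \<comment> \<open>\<open>tri_upd\<close> starts from a zero entry, so entry \<open>k\<close> is
    reset before it is set to \<open>t\<close>.\<close>
  define D0 where "D0 = D(k := 0)"
  let ?T = "tri (anf_L A) D0"
  \<comment> \<open>\<open>p\<close> is the effect on the output of a unit change in absolute value
    \<open>k\<close>, including its propagation through later switching variables; \<open>q\<close>
    is the gradient in \<open>x\<close> of component \<open>k\<close> of the slope system. The
    update is their outer product times \<open>t\<close>.\<close>
  define p where "p = anf_Y A k + (\<Sum>l<anf_s A. (D0 l * ?T (\<lambda>i. anf_L A i k) l) *\<^sub>R anf_Y A l)"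
  define q where "q = (\<chi> j. ?T (\<lambda>i. anf_Z A i \<bullet> axis j 1) k)"
  have L: "i \<le> k \<Longrightarrow> anf_L A i k = 0" for i using A k by (auto simp: is_anf_def)
  have "slope_matrix A (D(k := t)) = slope_matrix A D0 + t *\<^sub>R (\<chi> i j. p $ i * q $ j)" for t
  proof -
    have D: "D(k := t) = D0(k := t)" by (simp add: D0_def)
    have "(\<Sum>l<anf_s A. ((D0(k := t)) l * tri (anf_L A) (D0(k := t)) h l) *\<^sub>R anf_Y A l) =
        (\<Sum>l<anf_s A. (D0 l * ?T h l) *\<^sub>R anf_Y A l) + (t * ?T h k) *\<^sub>R p" for h
    proof -
      have r0: "?T (\<lambda>i. anf_L A i k) k = 0" using L by (rule tri_eq_0)
      have "(\<Sum>l<anf_s A. ((D0(k := t)) l * tri (anf_L A) (D0(k := t)) h l) *\<^sub>R anf_Y A l) =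
        (\<Sum>l<anf_s A. (D0 l * ?T h l) *\<^sub>R anf_Y A l +
          (t * ?T h k) *\<^sub>R ((D0 l * ?T (\<lambda>i. anf_L A i k) l) *\<^sub>R anf_Y A l) +
          (if l = k then (t * ?T h k) *\<^sub>R anf_Y A k else 0))"
        using tri_upd[of k "anf_L A" D0 t h, OF L] r0
        by (intro sum.cong refl) (auto simp: D0_def algebra_simps)
      also have "\<dots> = (\<Sum>l<anf_s A. (D0 l * ?T h l) *\<^sub>R anf_Y A l) + (t * ?T h k) *\<^sub>R p"
        using k by (simp add: sum.distrib p_def scaleR_right_distrib scaleR_sum_right)
      finally show ?thesis .
    qed
    then show ?thesis unfolding D
      by (simp add: vec_eq_iff slope_matrix_def matrix_def q_def mult_ac)
  qed
  then show ?thesis using det_rank_one_affine[of "slope_matrix A D0" p q] by simp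
qed

text \<open>Around a point whose switching vector is \<open>\<sigma>\<close> itself the signs stay
  constant, so each absolute value acts as multiplication by \<open>\<sigma> k\<close> and the
  function is affine.\<close>

lemma slope_matrix_piece:
  assumes A: "is_anf A" and rank: "full_row_rank A" and \<sigma>: "\<And>k. k < anf_s A \<Longrightarrow> \<bar>\<sigma> k\<bar> = 1"
  shows "\<exists>U a. open U \<and> U \<noteq> {} \<and> (\<forall>x\<in>U. anf_fun A x = slope_matrix A \<sigma> *v x + a)"
proof -
  let ?s = "anf_s A" and ?L = "anf_L A"
  \<comment> \<open>The entries of \<open>L\<close> are summed without factors because
    \<open>\<sigma>\<close> has absolute values 1.\<close>
  obtain x0 where x0: "\<And>i. i < ?s \<Longrightarrow> anf_Z A i \<bullet> x0 = \<sigma> i - anf_c A i - (\<Sum>j<?s. ?L i j)"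
    using rank[unfolded full_row_rank_def, rule_format, of "\<lambda>i. \<sigma> i - anf_c A i - (\<Sum>j<?s. ?L i j)"]
    by blast
  have \<sigma>\<sigma>: "\<sigma> k * \<sigma> k = 1" if "k < ?s" for k using \<sigma>[OF that] by (metis abs_mult_self_eq mult_1)
  \<comment> \<open>\<open>\<zeta> x\<close> is the deviation of the switching vector from
    \<open>\<sigma>\<close>; \<open>U\<close> asks that it changes no sign.\<close>
  define \<zeta> where "\<zeta> x k = tri ?L \<sigma> (\<lambda>i. anf_Z A i \<bullet> (x - x0)) k" for x k
  define U where "U = {x. \<forall>k\<in>{..<?s}. 0 < \<sigma> k * (\<sigma> k + \<zeta> x k)}"
  have U: "U = (\<Inter>k\<in>{..<?s}. {x. 0 < \<sigma> k * (\<sigma> k + \<zeta> x k)})" by (auto simp: U_def)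
  have "open {x. 0 < \<sigma> k * (\<sigma> k + \<zeta> x k)}" for k
    unfolding \<zeta>_def by (intro open_Collect_less continuous_intros continuous_on_tri)
  then have "open U" unfolding U by (intro open_INT finite_lessThan) simp
  moreover have "x0 \<in> U"
  proof -
    have "\<zeta> x0 k = 0" for k
      using tri_mult[of ?L \<sigma> 0 "\<lambda>i. 0" k] by (simp add: \<zeta>_def)
    then show ?thesis by (simp add: U_def \<sigma>\<sigma>)
  qed
  moreover have "anf_fun A x = slope_matrix A \<sigma> *v x +
      (anf_b A + anf_J A *v x0 + (\<Sum>k<?s. anf_Y A k) - slope_matrix A \<sigma> *v x0)" if x: "x \<in> U" for x
  proof (rule anf_fun_eqI[OF A])
    define z where "z k = \<sigma> k + \<zeta> x k" for k
    have z: "\<bar>z k\<bar> = 1 + \<sigma> k * \<zeta> x k" if "k < ?s" for k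
    proof -
      have "\<bar>z k\<bar> = \<bar>\<sigma> k * z k\<bar>" using \<sigma>[OF that] by (simp add: abs_mult)
      also have "\<dots> = \<sigma> k * z k"
        using x that unfolding U_def z_def by (intro abs_of_pos) blast
      also have "\<dots> = 1 + \<sigma> k * \<zeta> x k" using \<sigma>\<sigma>[OF that] by (simp add: z_def distrib_left)
      finally show ?thesis .
    qed
    show "anf_rel A x z (slope_matrix A \<sigma> *v x +
        (anf_b A + anf_J A *v x0 + (\<Sum>k<?s. anf_Y A k) - slope_matrix A \<sigma> *v x0))"
      unfolding anf_rel_def
    proof (intro conjI allI impI)
      fix i assume i: "i < ?s"
      have "(\<Sum>j<?s. ?L i j * \<bar>z j\<bar>) = (\<Sum>j<?s. ?L i j) + (\<Sum>j<?s. ?L i j * (\<sigma> j * \<zeta> x j))"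
        by (simp add: z distrib_left sum.distrib)
      moreover have "\<zeta> x i = anf_Z A i \<bullet> (x - x0) + (\<Sum>j<?s. ?L i j * (\<sigma> j * \<zeta> x j))"
        unfolding sum_strict_lower[OF A i] unfolding \<zeta>_def by (subst tri.simps) simp
      ultimately show "z i = anf_c A i + anf_Z A i \<bullet> x + (\<Sum>j<?s. ?L i j * \<bar>z j\<bar>)"
        using x0[OF i] by (simp add: z_def inner_diff_right)
    next
      have "(\<Sum>k<?s. \<bar>z k\<bar> *\<^sub>R anf_Y A k) =
          (\<Sum>k<?s. anf_Y A k) + (\<Sum>k<?s. (\<sigma> k * \<zeta> x k) *\<^sub>R anf_Y A k)"
        by (simp add: z scaleR_left_distrib sum.distrib)
      moreover have "slope_matrix A \<sigma> *v (x - x0) =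
          anf_J A *v (x - x0) + (\<Sum>k<?s. (\<sigma> k * \<zeta> x k) *\<^sub>R anf_Y A k)"
        by (simp add: slope_matrix_works \<zeta>_def)
      ultimately show "slope_matrix A \<sigma> *v x +
          (anf_b A + anf_J A *v x0 + (\<Sum>k<?s. anf_Y A k) - slope_matrix A \<sigma> *v x0) =
        anf_b A + anf_J A *v x + (\<Sum>k<?s. \<bar>z k\<bar> *\<^sub>R anf_Y A k)"
        by (simp add: matrix_vector_mult_diff_distrib algebra_simps)
    qed
  qed
  ultimately show ?thesis by blast
qed

lemma sgn_affine:
  fixes \<alpha> \<beta> t :: real
  assumes "sgn (\<alpha> + \<beta>) = \<tau>" "sgn (\<alpha> - \<beta>) = \<tau>" "\<tau> \<in> {1, -1}" "\<bar>t\<bar> \<le> 1"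
  shows "sgn (\<alpha> + \<beta> * t) = \<tau>"
proof -
  have t: "\<bar>\<beta> * t\<bar> \<le> \<bar>\<beta>\<bar>" using assms(4) by (simp add: abs_mult mult_left_le)
  consider "\<tau> = 1" | "\<tau> = -1" using assms(3) by blast
  then show ?thesis
  proof cases
    case 1
    then have "\<alpha> + \<beta> > 0" "\<alpha> - \<beta> > 0" using assms(1,2) by (simp_all only: sgn_1_pos)
    then have "\<alpha> + \<beta> * t > 0" using t by arith
    then show ?thesis using 1 by simp
  next
    case 2
    then have "\<alpha> + \<beta> < 0" "\<alpha> - \<beta> < 0" using assms(1,2) by (simp_all only: sgn_1_neg)
    then have "\<alpha> + \<beta> * t < 0" using t by arith
    then show ?thesis using 2 by simp
  qed
qed

text \<open>At a vertex of the cube the slope matrix is the linear part on an open set, so its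
  determinant has sign \<open>\<tau>\<close>. The determinant is affine in each entry of
  \<open>D\<close>, hence the sign spreads from the vertices to the whole cube and no slope matrix
  is singular.\<close>

lemma slope_regular_if_coherently_oriented:
  assumes A: "is_anf A" and rank: "full_row_rank A" and co: "coherently_oriented (anf_fun A)"
  shows "slope_regular A"
proof -
  obtain \<tau> where \<tau>: "\<tau> \<in> {1, -1::real}" and piece: "\<forall>M a U. open U \<and> U \<noteq> {} \<and>
      (\<forall>x\<in>U. anf_fun A x = M *v x + a) \<longrightarrow> sgn (det M) = \<tau>"
    using co unfolding coherently_oriented_def by (rule bexE)
  \<comment> \<open>The first \<open>k\<close> entries range over [-1, 1], the remaining relevant
    ones are 1 or -1. Induction on \<open>k\<close> leads from the vertices to the cube.\<close>
  have sgn: "sgn (det (slope_matrix A D)) = \<tau>"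
    if "k \<le> anf_s A" "\<And>j. \<bar>D j\<bar> \<le> 1" "\<And>j. k \<le> j \<Longrightarrow> j < anf_s A \<Longrightarrow> \<bar>D j\<bar> = 1" for D k
    using that
  proof (induction k arbitrary: D)
    case 0
    then obtain U a where "open U \<and> U \<noteq> {} \<and> (\<forall>x\<in>U. anf_fun A x = slope_matrix A D *v x + a)"
      using slope_matrix_piece[OF A rank, of D] by auto
    then show ?case by (rule piece[rule_format])
  next
    case (Suc k)
    obtain \<alpha> \<beta> where \<alpha>\<beta>: "\<And>t. det (slope_matrix A (D(k := t))) = \<alpha> + \<beta> * t"
      using det_slope_matrix_affine[OF A, of k D] Suc.prems(1) by auto
    have "sgn (det (slope_matrix A (D(k := t)))) = \<tau>" if "\<bar>t\<bar> = 1" for t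
      using Suc.prems that by (intro Suc.IH) (auto simp: not_less_eq_eq le_Suc_eq)
    from this[of 1] this[of "-1"] have "sgn (\<alpha> + \<beta>) = \<tau>" "sgn (\<alpha> - \<beta>) = \<tau>"
      by (simp_all add: \<alpha>\<beta>)
    then have "sgn (\<alpha> + \<beta> * D k) = \<tau>" using \<tau> Suc.prems(2) by (rule sgn_affine)
    then show ?case using \<alpha>\<beta>[of "D k"] by simp
  qed
  show ?thesis
    unfolding slope_regular_def
  proof (intro allI impI, elim conjE)
    fix D x z
    assume D: "\<forall>k. \<bar>D k\<bar> \<le> 1"
      and z: "\<forall>i<anf_s A. z i = anf_Z A i \<bullet> x + (\<Sum>j<anf_s A. anf_L A i j * (D j * z j))"
      and 0: "anf_J A *v x + (\<Sum>k<anf_s A. (D k * z k) *\<^sub>R anf_Y A k) = 0"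
    have "z i = tri (anf_L A) D (\<lambda>i. anf_Z A i \<bullet> x) i" if "i < anf_s A" for i
      using z that by (intro tri_eqI[OF A]) auto
    then have "slope_matrix A D *v x = 0" using 0 by (simp add: slope_matrix_works)
    moreover have "det (slope_matrix A D) \<noteq> 0"
      using sgn[of "anf_s A" D] D \<tau> by auto
    ultimately show "x = 0"
      by (metis invertible_det_nz invertible_left_inverse matrix_left_invertible_ker)
  qed
qed

section \<open>Perturbing \<open>Z\<close> to full row rank\<close>

lemma perturb_out_of_span:
  fixes a b x :: "'a::euclidean_space"
  assumes B: "dim B < DIM('a)" and b: "b \<in> span B" "b \<bullet> x \<noteq> 0" and e: "e > 0"
  shows "\<exists>p. dist p a < e \<and> p \<bullet> x = a \<bullet> x \<and> p \<notin> span B"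
proof (cases "a \<in> span B")
  case False
  then show ?thesis using e by (intro exI[of _ a]) simp
next
  case True
  \<comment> \<open>The hyperplane orthogonal to \<open>x\<close> cannot lie in
    \<open>span B\<close>: together with \<open>b\<close>, which is off the hyperplane, it spans the
    whole space. A small step along such a \<open>q\<close> preserves the product with
    \<open>x\<close>.\<close>
  have "\<exists>q. q \<bullet> x = 0 \<and> q \<notin> span B"
  proof (rule ccontr)
    assume neg: "\<nexists>q. q \<bullet> x = 0 \<and> q \<notin> span B"
    have "y \<in> span B" for y
    proof -
      define r where "r = (y \<bullet> x) / (b \<bullet> x)"
      have "(y - r *\<^sub>R b) \<bullet> x = 0" using b(2) by (simp add: r_def inner_diff_left)
      then have "y - r *\<^sub>R b \<in> span B" using neg by blast
      then have "(y - r *\<^sub>R b) + r *\<^sub>R b \<in> span B" using b(1) by (intro span_add span_mul)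
      then show ?thesis by simp
    qed
    then have "span B = UNIV" by blast
    then show False using B by (metis dim_UNIV dim_span less_irrefl)
  qed
  then obtain q where q: "q \<bullet> x = 0" "q \<notin> span B" by blast
  then have "q \<noteq> 0" using span_zero by metis
  define t where "t = e / (2 * norm q)"
  have t: "t > 0" using e \<open>q \<noteq> 0\<close> by (simp add: t_def)
  have "a + t *\<^sub>R q \<notin> span B"
  proof
    assume "a + t *\<^sub>R q \<in> span B"
    then have "(a + t *\<^sub>R q) - a \<in> span B" using True by (rule span_diff)
    then have "t *\<^sub>R q \<in> span B" by simp
    then have "(1 / t) *\<^sub>R (t *\<^sub>R q) \<in> span B" by (rule span_mul)
    moreover have "(1 / t) *\<^sub>R (t *\<^sub>R q) = q" using t by simp
    ultimately show False using q(2) by simp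
  qed
  moreover have "dist (a + t *\<^sub>R q) a < e"
    using e \<open>q \<noteq> 0\<close> by (simp add: dist_norm t_def)
  ultimately show ?thesis
    using q(1) by (intro exI[of _ "a + t *\<^sub>R q"]) (simp add: inner_add_left)
qed

text \<open>Rows are made independent one at a time, starting with row \<open>m\<close>, whose
  nonzero product with \<open>x\<close> is what \<open>perturb_out_of_span\<close> asks of the span.
  As \<open>s\<close> is at most the dimension, the rows already treated never fill the
  space.\<close>

lemma perturb_rows_independent:
  fixes Z :: "nat \<Rightarrow> 'a::euclidean_space"
  assumes s: "s \<le> DIM('a)" and m: "m < s" "Z m \<bullet> x \<noteq> 0" and e: "e > 0"
  shows "\<exists>Z'. (\<forall>i<s. dist (Z' i) (Z i) < e \<and> Z' i \<bullet> x = Z i \<bullet> x) \<and>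
    inj_on Z' {..<s} \<and> independent (Z' ` {..<s})"
proof -
  have "\<exists>Z'. (\<forall>i\<in>insert m I. dist (Z' i) (Z i) < e \<and> Z' i \<bullet> x = Z i \<bullet> x) \<and>
      inj_on Z' (insert m I) \<and> independent (Z' ` insert m I)"
    if "finite I" "I \<subseteq> {..<s} - {m}" for I
    using that
  proof (induction I rule: finite_induct)
    case empty
    have "Z m \<noteq> 0" using m(2) by auto
    then show ?case using e by (intro exI[of _ Z]) auto
  next
    case (insert i I)
    then obtain Z' where Z': "\<forall>i\<in>insert m I. dist (Z' i) (Z i) < e \<and> Z' i \<bullet> x = Z i \<bullet> x"
      "inj_on Z' (insert m I)" "independent (Z' ` insert m I)" by blast
    let ?B = "Z' ` insert m I"
    have "insert i (insert m I) \<subseteq> {..<s}" using insert.prems m(1) by auto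
    then have "card (insert i (insert m I)) \<le> s" by (metis card_lessThan card_mono finite_lessThan)
    moreover have i: "i \<notin> insert m I" using insert by auto
    ultimately have "card (insert m I) < s" using insert.hyps(1) by simp
    then have "dim ?B < DIM('a)"
      using s card_image_le[of "insert m I" Z'] dim_le_card'[of ?B] insert.hyps(1) by simp
    moreover have "Z' m \<in> span ?B" by (intro span_base) simp
    moreover have "Z' m \<bullet> x \<noteq> 0" using Z'(1) m(2) by simp
    ultimately obtain p where p: "dist p (Z i) < e" "p \<bullet> x = Z i \<bullet> x" "p \<notin> span ?B"
      using perturb_out_of_span e by blast
    define Z'' where "Z'' = Z'(i := p)"
    have im: "Z'' ` insert m I = ?B" using i by (auto simp: Z''_def)
    have eq: "insert m (insert i I) = insert i (insert m I)" by auto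
    have "\<forall>j\<in>insert m (insert i I). dist (Z'' j) (Z j) < e \<and> Z'' j \<bullet> x = Z j \<bullet> x"
      using Z'(1) p by (auto simp: Z''_def)
    moreover have "inj_on Z'' (insert i (insert m I))"
    proof -
      have "Z'' j = Z' j" if "j \<in> insert m I" for j
        using that i by (auto simp: Z''_def)
      then have "inj_on Z'' (insert m I)"
        using Z'(2) inj_on_cong[of "insert m I" Z'' Z'] by blast
      moreover have "Z'' i \<notin> Z'' ` (insert m I - {i})"
        using p(3) span_base[of p ?B] i im by (auto simp: Z''_def)
      ultimately show ?thesis by (simp only: inj_on_insert simp_thms)
    qed
    moreover have "independent (Z'' ` insert i (insert m I))"
      using independent_insertI[OF p(3) Z'(3)] unfolding image_insert[of _ i] im
      by (simp add: Z''_def)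
    ultimately show ?case unfolding eq by blast
  qed
  moreover have "insert m ({..<s} - {m}) = {..<s}" using m(1) by auto
  ultimately obtain Z' where "\<forall>i\<in>{..<s}. dist (Z' i) (Z i) < e \<and> Z' i \<bullet> x = Z i \<bullet> x"
    "inj_on Z' {..<s}" "independent (Z' ` {..<s})"
    by (metis finite_Diff finite_lessThan order_refl)
  then show ?thesis by auto
qed

text \<open>A linear functional with the prescribed values is represented as an inner product by its
  adjoint.\<close>

lemma independent_family_dual:
  fixes Z :: "nat \<Rightarrow> 'a::euclidean_space"
  assumes "inj_on Z {..<s}" "independent (Z ` {..<s})"
  shows "\<exists>x. \<forall>i<s. Z i \<bullet> x = h i"
proof -
  obtain g where g: "linear g" "\<forall>v\<in>Z ` {..<s}. g v = h (the_inv_into {..<s} Z v)"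
    using linear_independent_extend[OF assms(2), of "\<lambda>v. h (the_inv_into {..<s} Z v)"] by blast
  have "Z i \<bullet> adjoint g 1 = h i" if "i < s" for i
    using g that assms(1) by (simp add: adjoint_works the_inv_into_f_f)
  then show ?thesis by blast
qed

text \<open>The kernel equations see \<open>Z\<close> only through its products with
  \<open>x\<close>. A perturbation that preserves them keeps \<open>D\<close>, \<open>x\<close> and
  \<open>z\<close> as a witness.\<close>

lemma not_slope_regular_perturb:
  fixes A :: "'n::finite anf"
  assumes A: "is_anf A" and J: "invertible (anf_J A)" and s: "anf_s A \<le> CARD('n)"
    and irreg: "\<not> slope_regular A" and e: "e > 0"
  shows "\<exists>Z'. (\<forall>i<anf_s A. \<forall>j. \<bar>Z' i $ j - anf_Z A i $ j\<bar> < e) \<and>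
    full_row_rank (A\<lparr>anf_Z := Z'\<rparr>) \<and> \<not> slope_regular (A\<lparr>anf_Z := Z'\<rparr>)"
proof -
  obtain D x z where D: "\<forall>k. \<bar>D k\<bar> \<le> 1" and x: "x \<noteq> 0"
    and z: "\<forall>i<anf_s A. z i = anf_Z A i \<bullet> x + (\<Sum>j<anf_s A. anf_L A i j * (D j * z j))"
    and 0: "anf_J A *v x + (\<Sum>k<anf_s A. (D k * z k) *\<^sub>R anf_Y A k) = 0"
    using irreg unfolding slope_regular_def by blast
  \<comment> \<open>If all rows were orthogonal to \<open>x\<close>, forward substitution would give
    \<open>z = 0\<close> and then \<open>J x = 0\<close>, against the invertibility of
    \<open>J\<close>.\<close>
  have "\<exists>m<anf_s A. anf_Z A m \<bullet> x \<noteq> 0"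
  proof (rule ccontr)
    assume neg: "\<not> ?thesis"
    have "z i = (\<lambda>i. 0) i" if "i < anf_s A" for i
    proof (rule anf_switching_unique[OF A _ _ that, where h = "\<lambda>i. 0" and g = "\<lambda>j t. D j * t"])
      show "z i = 0 + (\<Sum>j<anf_s A. anf_L A i j * (D j * z j))" if "i < anf_s A" for i
        using z[rule_format, OF that] neg that by simp
    qed simp
    then have "anf_J A *v x = 0" using 0 by simp
    then have "x = 0"
      using J by (metis invertible_left_inverse matrix_left_invertible_ker)
    then show False using x by simp
  qed
  then obtain m where "m < anf_s A" "anf_Z A m \<bullet> x \<noteq> 0" by blast
  then obtain Z' where Z': "\<forall>i<anf_s A. dist (Z' i) (anf_Z A i) < e \<and> Z' i \<bullet> x = anf_Z A i \<bullet> x"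
    "inj_on Z' {..<anf_s A}" "independent (Z' ` {..<anf_s A})"
    using perturb_rows_independent[of "anf_s A" m "anf_Z A" x e] s e by auto
  have "\<forall>i<anf_s A. \<forall>j. \<bar>Z' i $ j - anf_Z A i $ j\<bar> < e"
  proof (intro allI impI)
    fix i j assume "i < anf_s A"
    then have "norm (Z' i - anf_Z A i) < e" using Z'(1) by (simp add: dist_norm)
    then show "\<bar>Z' i $ j - anf_Z A i $ j\<bar> < e"
      using component_le_norm_cart[of "Z' i - anf_Z A i" j] by simp
  qed
  moreover have "full_row_rank (A\<lparr>anf_Z := Z'\<rparr>)"
    unfolding full_row_rank_def using independent_family_dual[OF Z'(2,3)] by simp
  moreover have "\<not> slope_regular (A\<lparr>anf_Z := Z'\<rparr>)"
  proof
    assume reg: "slope_regular (A\<lparr>anf_Z := Z'\<rparr>)"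
    have z': "\<forall>i<anf_s A. z i = Z' i \<bullet> x + (\<Sum>j<anf_s A. anf_L A i j * (D j * z j))"
      using z Z'(1) by metis
    have "x = 0"
    proof (rule reg[unfolded slope_regular_def, THEN spec[of _ D], THEN spec[of _ x],
          THEN spec[of _ z], THEN mp], intro conjI)
      show "\<forall>i<anf_s (A\<lparr>anf_Z := Z'\<rparr>). z i = anf_Z (A\<lparr>anf_Z := Z'\<rparr>) i \<bullet> x +
          (\<Sum>j<anf_s (A\<lparr>anf_Z := Z'\<rparr>). anf_L (A\<lparr>anf_Z := Z'\<rparr>) i j * (D j * z j))"
      proof (intro allI impI)
        fix i assume "i < anf_s (A\<lparr>anf_Z := Z'\<rparr>)"
        then have "i < anf_s A" by simp
        from z'[rule_format, OF this]
        show "z i = anf_Z (A\<lparr>anf_Z := Z'\<rparr>) i \<bullet> x +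
          (\<Sum>j<anf_s (A\<lparr>anf_Z := Z'\<rparr>). anf_L (A\<lparr>anf_Z := Z'\<rparr>) i j * (D j * z j))"
          by simp
      qed
    qed (use D 0 in simp_all)
    then show False using x by simp
  qed
  ultimately show ?thesis by blast
qed

text \<open>Perturbing \<open>Z\<close> alone is a special case of perturbing all data, which leaves
  three conditions. An irregular form has irregular neighbours of full row rank, where both coherent
  orientation and injectivity fail.\<close>

lemma slope_regular_if_stable:
  fixes A :: "'n::finite anf"
  assumes A: "is_anf A" and J: "invertible (anf_J A)" and s: "anf_s A \<le> CARD('n)"
    and cond: "stably_coherently_oriented A \<or> stably_bijective A \<or>
         under_small_perturbations coherently_oriented A \<or>
         under_small_perturbations bij A \<or>
         ave_uniquely_solvable (anf_s A) (ave_matrix A)"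
  shows "slope_regular A"
proof (rule ccontr)
  assume irreg: "\<not> slope_regular A"
  have A': "is_anf (A\<lparr>anf_Z := Z'\<rparr>)" for Z' using A by (simp add: is_anf_def)
  have small: "stably_Z Q A" if Q: "under_small_perturbations Q A" for Q
  proof -
    obtain e where e: "e > 0 \<and> (\<forall>B. is_anf B \<and> anf_close e B A \<longrightarrow> Q (anf_fun B))"
      using Q unfolding under_small_perturbations_def by (rule exE)
    show ?thesis unfolding stably_Z_def
    proof (intro exI[of _ e] conjI allI impI)
      fix Z' :: "nat \<Rightarrow> real^'n"
      assume "\<forall>i<anf_s A. \<forall>j. \<bar>Z' i $ j - anf_Z A i $ j\<bar> < e"
      then have "anf_close e (A\<lparr>anf_Z := Z'\<rparr>) A" using e by (simp add: anf_close_def)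
      with A' show "Q (anf_fun (A\<lparr>anf_Z := Z'\<rparr>))"
        by (intro e[THEN conjunct2, rule_format] conjI)
    qed (rule e[THEN conjunct1])
  qed
  consider "stably_Z coherently_oriented A" | "stably_Z bij A"
    | "ave_uniquely_solvable (anf_s A) (ave_matrix A)"
    using cond small unfolding stably_coherently_oriented_def stably_bijective_def by blast
  then show False
  proof cases
    case 1
    then obtain e where e: "e > 0 \<and> (\<forall>Z'. (\<forall>i<anf_s A. \<forall>j. \<bar>Z' i $ j - anf_Z A i $ j\<bar> < e) \<longrightarrow>
        coherently_oriented (anf_fun (A\<lparr>anf_Z := Z'\<rparr>)))"
      unfolding stably_Z_def by (rule exE)
    obtain Z' where Z': "\<forall>i<anf_s A. \<forall>j. \<bar>Z' i $ j - anf_Z A i $ j\<bar> < e"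
      "full_row_rank (A\<lparr>anf_Z := Z'\<rparr>)" "\<not> slope_regular (A\<lparr>anf_Z := Z'\<rparr>)"
      using not_slope_regular_perturb[OF A J s irreg e[THEN conjunct1]] by (elim exE conjE)
    have "coherently_oriented (anf_fun (A\<lparr>anf_Z := Z'\<rparr>))"
      by (rule e[THEN conjunct2, THEN spec, THEN mp, OF Z'(1)])
    then show False using slope_regular_if_coherently_oriented[OF A' Z'(2)] Z'(3) by simp
  next
    case 2
    then obtain e where e: "e > 0 \<and> (\<forall>Z'. (\<forall>i<anf_s A. \<forall>j. \<bar>Z' i $ j - anf_Z A i $ j\<bar> < e) \<longrightarrow>
        bij (anf_fun (A\<lparr>anf_Z := Z'\<rparr>)))"
      unfolding stably_Z_def by (rule exE)
    obtain Z' where Z': "\<forall>i<anf_s A. \<forall>j. \<bar>Z' i $ j - anf_Z A i $ j\<bar> < e"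
      "full_row_rank (A\<lparr>anf_Z := Z'\<rparr>)" "\<not> slope_regular (A\<lparr>anf_Z := Z'\<rparr>)"
      using not_slope_regular_perturb[OF A J s irreg e[THEN conjunct1]] by (elim exE conjE)
    have "bij (anf_fun (A\<lparr>anf_Z := Z'\<rparr>))"
      by (rule e[THEN conjunct2, THEN spec, THEN mp, OF Z'(1)])
    then show False using slope_regular_if_inj[OF A' Z'(2)] Z'(3) bij_is_inj by blast
  next
    case 3
    then show False using slope_regular_if_ave_uniquely_solvable[OF J] irreg by blast
  qed
qed

section \<open>Bijectivity of the linearizations\<close>

definition slope_map ::
    "'n procedure \<Rightarrow> real^'n \<Rightarrow> real^'n \<Rightarrow> (nat \<Rightarrow> real) \<Rightarrow> real^'n \<Rightarrow> real^'n" where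
  "slope_map P xc xh D dx = (\<chi> i. diff_at P xc xh (\<lambda>k v. D k * v) dx (outs P i))"

lemma tangent_anf_s [simp]: "anf_s (tangent_anf P x) = abs_count P"
  by (simp add: tangent_anf_def Let_def)

lemma smooth_at_partial_x:
  fixes P :: "'n::finite procedure"
  assumes lib: "elemental_library \<Phi>" and P: "procedure_over \<Phi> P"
    and wd: "well_defined_at P x" and r: "available (length (instrs P)) r"
  shows "partial_x (\<lambda>y. smooth_at P y (\<lambda>k. \<bar>switching P x k\<bar>) r) x i =
    diff_at P x x (\<lambda>k v. 0) (axis i 1) r"
  unfolding partial_x_def
  by (intro DERIV_imp_deriv smooth_at_has_derivative[OF lib P wd r,
        where X = "\<lambda>t. x + t *\<^sub>R axis i 1" and W = "\<lambda>t k. \<bar>switching P x k\<bar>"])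
     (auto intro!: derivative_eq_intros)

lemma smooth_at_partial_w:
  fixes P :: "'n::finite procedure"
  assumes lib: "elemental_library \<Phi>" and P: "procedure_over \<Phi> P"
    and wd: "well_defined_at P x" and r: "available (length (instrs P)) r"
  shows "partial_w (\<lambda>u. smooth_at P x u r) (\<lambda>k. \<bar>switching P x k\<bar>) l =
    diff_at P x x (\<lambda>k v. if k = l then 1 else 0) 0 r"
  unfolding partial_w_def
  by (intro DERIV_imp_deriv smooth_at_has_derivative[OF lib P wd r,
        where X = "\<lambda>t. x" and W = "\<lambda>t. (\<lambda>k. \<bar>switching P x k\<bar>)(l := t)"])
     (auto intro!: derivative_eq_intros)

context
  fixes P :: "'n::finite procedure" and \<Phi> x
  assumes lib: "elemental_library \<Phi>" and P: "procedure_over \<Phi> P" and wd: "well_defined_at P x"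
begin

lemma tangent_anf_Z:
  "k < abs_count P \<Longrightarrow>
    anf_Z (tangent_anf P x) k $ i = diff_at P x x (\<lambda>k v. 0) (axis i 1) (abs_args (instrs P) ! k)"
  using smooth_at_partial_x[OF lib P wd available_abs_args[OF P]]
  by (simp add: tangent_anf_def Let_def smooth_G_def)

lemma tangent_anf_L:
  "k < abs_count P \<Longrightarrow> anf_L (tangent_anf P x) k l =
    diff_at P x x (\<lambda>k v. if k = l then 1 else 0) 0 (abs_args (instrs P) ! k)"
  using smooth_at_partial_w[OF lib P wd available_abs_args[OF P]]
  by (simp add: tangent_anf_def Let_def smooth_G_def)

lemma tangent_anf_J:
  "anf_J (tangent_anf P x) $ a $ i = diff_at P x x (\<lambda>k v. 0) (axis i 1) (outs P a)"
  using smooth_at_partial_x[OF lib P wd available_outs[OF P]]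
  by (simp add: tangent_anf_def Let_def smooth_F_def)

lemma tangent_anf_Y:
  "anf_Y (tangent_anf P x) l $ a =
    diff_at P x x (\<lambda>k v. if k = l then 1 else 0) 0 (outs P a)"
  using smooth_at_partial_w[OF lib P wd available_outs[OF P]]
  by (simp add: tangent_anf_def Let_def smooth_F_def)

lemma is_anf_tangent_anf: "is_anf (tangent_anf P x)"
  unfolding is_anf_def tangent_anf_s
proof (intro allI impI)
  fix i j assume ij: "i < abs_count P" "j < abs_count P" "i \<le> j"
  obtain p where p: "p < length (instrs P)" "instrs P ! p = Abs (abs_args (instrs P) ! i)"
    "abs_index (instrs P) p = i"
    using abs_args_nth ij(1) unfolding abs_count_def by blast
  then have "available p (abs_args (instrs P) ! i)"
    using procedure_over_available[OF P, of p] by simp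
  then show "anf_L (tangent_anf P x) i j = 0"
    using diff_at_later_abs[OF P] p ij by (simp add: tangent_anf_L)
qed

text \<open>Freezing and superposition identify the slope map at \<open>x\<close> with the slope
  system of the tangent abs-normal form.\<close>

lemma slope_map_eq_0_imp:
  assumes reg: "slope_regular (tangent_anf P x)" and D: "\<And>k. \<bar>D k\<bar> \<le> 1"
    and 0: "slope_map P x x D dx = 0"
  shows "dx = 0"
proof -
  define A where "A = tangent_anf P x"
  define z where "z k = diff_at P x x (\<lambda>k v. D k * v) dx (abs_args (instrs P) ! k)" for k
  have expand: "diff_at P x x (\<lambda>k v. D k * v) dx r =
      (\<Sum>i\<in>UNIV. dx $ i * diff_at P x x (\<lambda>k v. 0) (axis i 1) r) +
      (\<Sum>l<abs_count P. (D l * z l) * diff_at P x x (\<lambda>k v. if k = l then 1 else 0) 0 r)"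
    if "available (length (instrs P)) r" for r
    by (rule trans[OF diff_at_slope[OF P that] diff_at_linear_sum[OF P that]]) (simp add: z_def)
  have "z i = anf_Z A i \<bullet> dx + (\<Sum>j<abs_count P. anf_L A i j * (D j * z j))" if "i < abs_count P" for i
    using that unfolding z_def[of i] expand[OF available_abs_args[OF P that]]
    by (simp add: A_def inner_vec_def tangent_anf_Z tangent_anf_L mult.commute)
  moreover have "anf_J A *v dx + (\<Sum>k<abs_count P. (D k * z k) *\<^sub>R anf_Y A k) = 0"
  proof (subst vec_eq_iff, intro allI)
    fix a
    have "diff_at P x x (\<lambda>k v. D k * v) dx (outs P a) = 0"
      using 0 by (simp add: slope_map_def vec_eq_iff)
    then show "(anf_J A *v dx + (\<Sum>k<abs_count P. (D k * z k) *\<^sub>R anf_Y A k)) $ a = 0 $ a"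
      unfolding expand[OF available_outs[OF P, of a]]
      by (simp add: A_def matrix_vector_mult_def tangent_anf_J tangent_anf_Y mult.commute)
  qed
  ultimately show ?thesis
    using reg D unfolding slope_regular_def A_def tangent_anf_s by blast
qed

end

section \<open>Uniform lower bounds by compactness\<close>

lemma compact_cube: "compact {D :: nat \<Rightarrow> real. \<forall>k. \<bar>D k\<bar> \<le> 1}"
proof -
  \<comment> \<open>Tychonoff's theorem.\<close>
  have "compactin (product_topology (\<lambda>i. euclidean) UNIV) (PiE UNIV (\<lambda>i::nat. {-1..1::real}))"
    by (simp add: compactin_PiE)
  moreover have "PiE UNIV (\<lambda>i::nat. {-1..1::real}) = {D. \<forall>k. \<bar>D k\<bar> \<le> 1}"
    by (auto simp: PiE_def Pi_def abs_le_iff)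
  ultimately show ?thesis by (simp add: euclidean_product_topology)
qed

lemma slope_map_scaleR:
  assumes "procedure_over \<Phi> P"
  shows "slope_map P xc xh D (c *\<^sub>R dx) = c *\<^sub>R slope_map P xc xh D dx"
  using diff_at_scaleR[OF assms available_outs[OF assms]]
  by (simp add: slope_map_def vec_eq_iff)

text \<open>A single \<open>c\<close> bounds both the distances and the growth, so failure for every
  \<open>1 / Suc n\<close> yields one sequence of counterexamples. After normalization, a limit of a
  subsequence would be a kernel vector of a slope map at \<open>x\<close> itself.\<close>

lemma slope_map_lower_bound:
  fixes P :: "'n::finite procedure"
  assumes lib: "elemental_library \<Phi>" and P: "procedure_over \<Phi> P" and wd: "well_defined_at P x"
    and inj: "\<And>D dx. (\<And>k. \<bar>D k\<bar> \<le> 1) \<Longrightarrow> slope_map P x x D dx = 0 \<Longrightarrow> dx = 0"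
  obtains c where "c > 0" "\<And>xc xh D dx. dist xc x < c \<Longrightarrow> dist xh x < c \<Longrightarrow> (\<And>k. \<bar>D k\<bar> \<le> 1) \<Longrightarrow>
    c * norm dx \<le> norm (slope_map P xc xh D dx)"
proof -
  have "\<exists>c>0. \<forall>xc xh D dx. dist xc x < c \<longrightarrow> dist xh x < c \<longrightarrow> (\<forall>k. \<bar>D k\<bar> \<le> 1) \<longrightarrow>
    c * norm dx \<le> norm (slope_map P xc xh D dx)"
  proof (rule ccontr)
    assume neg: "\<not> ?thesis"
    have "\<exists>xc xh D dx. dist xc x < 1 / Suc n \<and> dist xh x < 1 / Suc n \<and> (\<forall>k. \<bar>D k\<bar> \<le> 1) \<and>
        norm (slope_map P xc xh D dx) < 1 / Suc n * norm dx" for n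
    proof -
      have "(0::real) < 1 / Suc n" by simp
      then show ?thesis using neg unfolding not_le[symmetric] by blast
    qed
    then obtain xc xh D dx where *: "\<And>n. dist (xc n) x < 1 / Suc n" "\<And>n. dist (xh n) x < 1 / Suc n"
      "\<And>n k. \<bar>D n k\<bar> \<le> (1::real)"
      "\<And>n. norm (slope_map P (xc n) (xh n) (D n) (dx n)) < 1 / Suc n * norm (dx n)"
      by metis
    define u where "u n = (1 / norm (dx n)) *\<^sub>R dx n" for n
    have dx0: "dx n \<noteq> 0" for n
    proof
      assume "dx n = 0"
      then show False using *(4)[of n] by simp
    qed
    have u: "norm (u n) = 1" for n using dx0[of n] by (simp add: u_def)
    have small: "norm (slope_map P (xc n) (xh n) (D n) (u n)) < 1 / Suc n" for n
      using *(4)[of n] dx0[of n] by (simp add: u_def slope_map_scaleR[OF P] field_simps)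
    define C where "C = {D :: nat \<Rightarrow> real. \<forall>k. \<bar>D k\<bar> \<le> 1} \<times> sphere (0::real^'n) 1"
    have "compact C" unfolding C_def by (intro compact_Times compact_cube compact_sphere)
    then have "seq_compact C" by (rule compact_imp_seq_compact)
    moreover have "\<forall>n. (D n, u n) \<in> C" using *(3) u by (simp add: C_def)
    ultimately obtain l s where l: "l \<in> C" "strict_mono s" "((\<lambda>n. (D n, u n)) \<circ> s) \<longlonglongrightarrow> l"
      by (rule seq_compactE)
    obtain D0 u0 where l0: "l = (D0, u0)" by fastforce
    have Du: "(\<lambda>n. D (s n)) \<longlonglongrightarrow> D0" "(\<lambda>n. u (s n)) \<longlonglongrightarrow> u0"
      using tendsto_fst[OF l(3)] tendsto_snd[OF l(3)] by (simp_all add: l0 o_def)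
    have Dk: "(\<lambda>n. D (s n) k) \<longlonglongrightarrow> D0 k" for k
      using continuous_on_tendsto_compose[OF continuous_on_product_coordinates Du(1)] by simp
    have inv: "(\<lambda>n. 1 / real (Suc (s n))) \<longlonglongrightarrow> 0"
      using LIMSEQ_subseq_LIMSEQ[OF LIMSEQ_inverse_real_of_nat l(2)]
      by (simp add: o_def inverse_eq_divide)
    have conv: "(\<lambda>n. y (s n)) \<longlonglongrightarrow> x" if "\<And>n. dist (y n) x < 1 / Suc n" for y
      by (rule metric_tendsto_imp_tendsto[OF inv])
         (use that less_imp_le in \<open>auto intro!: always_eventually simp: dist_real_def\<close>)
    have "(\<lambda>n. slope_map P (xc (s n)) (xh (s n)) (D (s n)) (u (s n))) \<longlonglongrightarrow> slope_map P x x D0 u0"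
      unfolding slope_map_def
      by (intro vec_tendstoI, simp)
         (intro tendsto_diff_at[OF lib P wd available_outs[OF P]] conv *(1,2) Dk Du(2))
    moreover have "(\<lambda>n. slope_map P (xc (s n)) (xh (s n)) (D (s n)) (u (s n))) \<longlonglongrightarrow> 0"
      by (rule Lim_null_comparison[OF _ inv])
         (use small less_imp_le in \<open>auto intro!: always_eventually\<close>)
    ultimately have "slope_map P x x D0 u0 = 0" by (rule LIMSEQ_unique)
    moreover have "norm u0 = 1" "\<And>k. \<bar>D0 k\<bar> \<le> 1" using l(1) by (auto simp: l0 C_def)
    ultimately show False using inj[of D0 u0] by force
  qed
  then show ?thesis using that by blast
qed

text \<open>The range is open by invariance of domain, and closed because the preimages of a
  convergent sequence are Cauchy; by connectedness it is the whole space.\<close>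

lemma bij_if_expanding:
  fixes f :: "'a::euclidean_space \<Rightarrow> 'a"
  assumes cont: "continuous_on UNIV f" and c: "c > 0"
    and le: "\<And>x y. c * dist x y \<le> dist (f x) (f y)"
  shows "bij f"
proof -
  have inj: "inj f"
  proof
    fix x y assume "f x = f y"
    then have "c * dist x y \<le> 0" using le[of x y] by simp
    then have "dist x y \<le> 0" using c by (metis mult_le_0_iff not_less zero_le_dist)
    then show "x = y" by simp
  qed
  have op: "open (range f)"
    using invariance_of_domain[OF cont open_UNIV inj] .
  have "closed (range f)"
  proof (rule closed_sequential_limits[THEN iffD2], intro allI impI)
    fix y l assume yl: "(\<forall>n. y n \<in> range f) \<and> y \<longlonglongrightarrow> l"
    then have y: "y n \<in> range f" for n by blast
    have l: "y \<longlonglongrightarrow> l" using yl by blast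
    define x where "x n = inv f (y n)" for n
    have x: "y n = f (x n)" for n using f_inv_into_f[OF y] by (simp add: x_def)
    have "Cauchy x"
    proof (rule metric_CauchyI)
      fix e :: real assume "e > 0"
      then obtain M where M: "\<And>m n. m \<ge> M \<Longrightarrow> n \<ge> M \<Longrightarrow> dist (y m) (y n) < c * e"
        using metric_CauchyD[OF LIMSEQ_imp_Cauchy[OF l], of "c * e"] c by auto
      have "dist (x m) (x n) < e" if "m \<ge> M" "n \<ge> M" for m n
      proof -
        have "c * dist (x m) (x n) < c * e"
          using M[OF that] le[of "x m" "x n"] by (simp add: x)
        then show ?thesis using c by simp
      qed
      then show "\<exists>M. \<forall>m\<ge>M. \<forall>n\<ge>M. dist (x m) (x n) < e" by blast
    qed
    then obtain a where "x \<longlonglongrightarrow> a" using Cauchy_convergent convergent_def by blast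
    then have "y \<longlonglongrightarrow> f a"
      using continuous_on_tendsto_compose[OF cont, of x a] by (simp flip: x)
    then show "l \<in> range f" using LIMSEQ_unique[OF l] by blast
  qed
  with op have "range f = UNIV" using clopen[of "range f"] by auto
  with inj show ?thesis by (simp add: bij_def)
qed

text \<open>This reduces tangent mode to secant mode, in which bijectivity and contraction are
  proved.\<close>

lemma tangent_lin_eq_secant_lin: "tangent_lin P x = secant_lin P x x"
proof -
  have "secant_step P x x dx = tangent_step P x dx" for dx
  proof (intro ext)
    fix ds i show "secant_step P x x dx ds i = tangent_step P x dx ds i"
      by (cases i) simp_all
  qed
  then show ?thesis
    by (intro ext) (simp add: tangent_lin_def secant_lin_def tangent_increment_def
        secant_increment_def flip: scaleR_2)
qed

lemma isCont_secant_at: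
  assumes P: "procedure_over \<Phi> P" and r: "available (length (instrs P)) r"
  shows "isCont (\<lambda>dx. secant_at P xc xh dx r) dx"
  using P r
proof (induction r rule: address_induct)
  case (Result k)
  have IH: "isCont (\<lambda>dx. secant_at P xc xh dx r) dx" if "r \<in> set_instr (instrs P ! k)" for r
    using Result(2) that by blast
  show ?case
    by (cases "instrs P ! k")
       (use IH in \<open>auto simp: secant_at_Result[OF P Result(1)] intro!: continuous_intros\<close>)
qed (simp add: continuous_component)

lemma continuous_secant_lin:
  assumes P: "procedure_over \<Phi> P"
  shows "continuous_on UNIV (secant_lin P xc xh)"
proof -
  have "continuous_on UNIV (\<lambda>dx. secant_at P xc xh dx (outs P i))" for i
    using isCont_secant_at[OF P available_outs[OF P]] continuous_at_imp_continuous_on by blast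
  then have "continuous_on UNIV (secant_increment P xc xh)"
    unfolding secant_increment_def secant_at_def[symmetric]
    by (intro continuous_on_vec_lambda)
  then show ?thesis unfolding secant_lin_def
    by (intro continuous_intros) (rule continuous_on_compose2, auto intro!: continuous_intros)
qed

lemma secant_lin_diff:
  assumes P: "procedure_over \<Phi> P"
  shows "\<exists>D. (\<forall>k. \<bar>D k\<bar> \<le> 1) \<and>
    secant_lin P xc xh x - secant_lin P xc xh y = slope_map P xc xh D (x - y)"
proof -
  define m where "m = (1/2) *\<^sub>R (xc + xh)"
  define D where "D = (\<lambda>k. let a = abs_args (instrs P) ! k; v = secant_at P xc xh (x - m) a;
      u = secant_at P xc xh (y - m) a; m = mid_at P xc xh a in (\<bar>m + v\<bar> - \<bar>m + u\<bar>) / (v - u))"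
  have "\<bar>D k\<bar> \<le> 1" for k unfolding D_def Let_def by (rule abs_quotient_le)
  moreover have "secant_lin P xc xh x - secant_lin P xc xh y = slope_map P xc xh D (x - y)"
    using secant_at_diff[OF P available_outs[OF P] D_def]
    by (simp add: vec_eq_iff secant_lin_def secant_increment_def slope_map_def flip: secant_at_def m_def)
  ultimately show ?thesis by blast
qed

text \<open>The quotients \<open>D\<close> relating two values depend on the arguments, but they all
  lie in the cube, so one expansion constant serves for all pairs.\<close>

lemma secant_lin_bij_near:
  fixes P :: "'n::finite procedure"
  assumes lib: "elemental_library \<Phi>" and P: "procedure_over \<Phi> P" and wd: "well_defined_at P x"
    and reg: "slope_regular (tangent_anf P x)"
  obtains c where "c > 0"
    "\<And>xc xh. dist xc x < c \<Longrightarrow> dist xh x < c \<Longrightarrow> bij (secant_lin P xc xh)"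
proof -
  have inj: "dx = 0" if "\<And>k. \<bar>D k\<bar> \<le> 1" "slope_map P x x D dx = 0" for D dx
    by (rule slope_map_eq_0_imp[OF lib P wd reg that])
  obtain c where c: "c > 0" "\<And>xc xh D dx. dist xc x < c \<Longrightarrow> dist xh x < c \<Longrightarrow> (\<And>k. \<bar>D k\<bar> \<le> 1) \<Longrightarrow>
      c * norm dx \<le> norm (slope_map P xc xh D dx)"
    by (rule slope_map_lower_bound[OF lib P wd inj]) auto
  have "bij (secant_lin P xc xh)" if "dist xc x < c" "dist xh x < c" for xc xh
  proof (rule bij_if_expanding[OF continuous_secant_lin[OF P] c(1)])
    fix y z
    show "c * dist y z \<le> dist (secant_lin P xc xh y) (secant_lin P xc xh z)"
      using secant_lin_diff[OF P, of xc xh y z] c(2)[OF that] by (auto simp: dist_norm)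
  qed
  with c(1) that show ?thesis by blast
qed

section \<open>Newton iterations\<close>

lemma is_norm_nonneg:
  assumes "is_norm N"
  shows "0 \<le> N x"
proof -
  have "N 0 = 0" and tri: "\<And>x y. N (x + y) \<le> N x + N y" and hom: "\<And>a x. N (a *\<^sub>R x) = \<bar>a\<bar> * N x"
    using assms unfolding is_norm_def by blast+
  \<comment> \<open>Nonnegativity follows from \<open>0 = N (x - x) \<le> N x + N x\<close>.\<close>
  then show ?thesis using tri[of x "(-1) *\<^sub>R x"] hom[of "-1" x] by simp
qed

lemma is_norm_minus_commute: "is_norm N \<Longrightarrow> N (x - y) = N (y - x)"
  unfolding is_norm_def by (metis abs_minus_cancel abs_one minus_diff_eq mult_1 scaleR_minus1_left)

lemma is_norm_triangle: "is_norm N \<Longrightarrow> N (x - y) \<le> N (x - z) + N (y - z)"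
  using is_norm_minus_commute[of N y z] unfolding is_norm_def by (metis diff_add_cancel add_diff_eq)

lemma is_norm_le_norm:
  fixes N :: "'a::euclidean_space \<Rightarrow> real"
  assumes N: "is_norm N"
  shows "N x \<le> (\<Sum>b\<in>Basis. N b) * norm x"
proof -
  have sum: "N (sum f A) \<le> (\<Sum>a\<in>A. N (f a))" if "finite A" for f :: "'a \<Rightarrow> 'a" and A
    using that
  proof (induction A rule: finite_induct)
    case empty
    have "N 0 = 0" using N unfolding is_norm_def by blast
    then show ?case by simp
  next
    case (insert a A)
    have "N (f a + sum f A) \<le> N (f a) + N (sum f A)" using N by (simp add: is_norm_def)
    with insert show ?case by simp
  qed
  have "N x = N (\<Sum>b\<in>Basis. (x \<bullet> b) *\<^sub>R b)" by (simp add: euclidean_representation)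
  also have "\<dots> \<le> (\<Sum>b\<in>Basis. N ((x \<bullet> b) *\<^sub>R b))" by (rule sum) simp
  also have "\<dots> \<le> (\<Sum>b\<in>Basis. N b * norm x)"
  proof (rule sum_mono)
    fix b :: 'a assume "b \<in> Basis"
    then have "\<bar>x \<bullet> b\<bar> * N b \<le> norm x * N b"
      by (intro mult_right_mono Basis_le_norm is_norm_nonneg[OF N])
    then show "N ((x \<bullet> b) *\<^sub>R b) \<le> N b * norm x"
      using N by (simp add: is_norm_def mult.commute)
  qed
  finally show ?thesis by (simp add: sum_distrib_right)
qed

text \<open>By the upper bound \<open>N\<close> is Lipschitz, so it attains a positive minimum on
  the compact unit sphere; scaling does the rest. The lemma translates estimates in \<open>N\<close>
  into convergence in the topology of the type.\<close>

lemma is_norm_ge_norm: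
  fixes N :: "'a::euclidean_space \<Rightarrow> real"
  assumes N: "is_norm N"
  obtains c where "c > 0" "\<And>x. c * norm x \<le> N x"
proof -
  define C where "C = (\<Sum>b\<in>Basis. N (b::'a))"
  have C: "0 \<le> C" unfolding C_def by (intro sum_nonneg is_norm_nonneg[OF N])
  have tri: "N x - N y \<le> N (x - y)" for x y
  proof -
    have "N ((x - y) + y) \<le> N (x - y) + N y" using N unfolding is_norm_def by blast
    then show ?thesis by simp
  qed
  have "C-lipschitz_on UNIV N"
  proof (rule lipschitz_onI[OF _ C])
    fix x y :: 'a
    have "\<bar>N x - N y\<bar> \<le> N (x - y)"
      using tri[of x y] tri[of y x] is_norm_minus_commute[OF N, of x y] by simp
    also have "\<dots> \<le> C * norm (x - y)" unfolding C_def by (rule is_norm_le_norm[OF N])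
    finally show "dist (N x) (N y) \<le> C * dist x y" by (simp add: dist_norm)
  qed
  then have "continuous_on (sphere 0 1) N"
    using lipschitz_on_continuous_on continuous_on_subset by blast
  moreover have "sphere (0::'a) 1 \<noteq> {}" by simp
  ultimately obtain u where u: "norm u = 1" "\<And>x. norm x = 1 \<Longrightarrow> N u \<le> N x"
    using continuous_attains_inf[OF compact_sphere, of "0::'a" 1 N] by auto
  have "u \<noteq> 0" using u(1) by auto
  then have "N u > 0" using is_norm_nonneg[OF N, of u] N by (metis is_norm_def less_le)
  moreover have "N u * norm x \<le> N x" for x
  proof (cases "x = 0")
    case True
    then show ?thesis using is_norm_nonneg[OF N] by simp
  next
    case False
    then have "N u \<le> N ((1 / norm x) *\<^sub>R x)" by (intro u(2)) simp
    also have "\<dots> = \<bar>1 / norm x\<bar> * N x" using N unfolding is_norm_def by blast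
    finally show ?thesis using False by (simp add: field_simps)
  qed
  ultimately show ?thesis using that by blast
qed

lemma is_norm_geometric_tendsto:
  fixes X :: "nat \<Rightarrow> 'a::euclidean_space"
  assumes N: "is_norm N" and le: "\<And>j. N (X j - a) \<le> B * (1/2) ^ j"
  shows "X \<longlonglongrightarrow> a"
proof -
  obtain c where c: "c > 0" "\<And>x. c * norm x \<le> N x" using is_norm_ge_norm[OF N] by blast
  have "norm (X j - a) \<le> B / c * (1/2) ^ j" for j
    using order_trans[OF c(2) le[of j]] c(1) by (simp add: field_simps)
  moreover have "(\<lambda>j. B / c * (1/2) ^ j) \<longlonglongrightarrow> 0"
    by (intro tendsto_mult_right_zero LIMSEQ_power_zero) simp
  ultimately have "(\<lambda>j. X j - a) \<longlonglongrightarrow> 0"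
    by (intro Lim_null_comparison[of "\<lambda>j. X j - a"] always_eventually) auto
  then show ?thesis by (simp add: LIM_zero_iff)
qed

text \<open>A bijection leaves one root, which is the minimizer for every objective. This makes a
  Newton step single-valued.\<close>

lemma is_arg_min_root_iff:
  fixes f :: "'a \<Rightarrow> 'b::preorder"
  assumes "bij g"
  shows "is_arg_min f (\<lambda>x. g x = c) y \<longleftrightarrow> y = inv g c"
proof -
  have "g x = c \<longleftrightarrow> x = inv g c" for x using assms by (metis bij_inv_eq_iff)
  then show ?thesis by (auto simp: is_arg_min_def)
qed

text \<open>In the ball the relation \<open>A\<close> is the graph of \<open>T\<close>, and the
  contraction keeps the iterates there. Hence every path from \<open>x0\<close> is the orbit of
  \<open>T\<close>.\<close>

lemma one_step_iteration:
  fixes T :: "'a::euclidean_space \<Rightarrow> 'a"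
  assumes N: "is_norm N"
    and wd: "\<And>a. N (a - x) \<le> R \<Longrightarrow> W a"
    and T: "\<And>a y. N (a - x) \<le> R \<Longrightarrow> A a y \<longleftrightarrow> y = T a"
    and contr: "\<And>a. N (a - x) \<le> R \<Longrightarrow> N (T a - x) \<le> N (a - x) / 5"
    and x0: "N (x0 - x) \<le> R"
  shows "(\<exists>!X. (\<forall>j. W (X j) \<and> A (X j) (X (Suc j))) \<and> X 0 = x0) \<and>
    (\<forall>X. (\<forall>j. W (X j) \<and> A (X j) (X (Suc j))) \<and> X 0 = x0 \<longrightarrow> X \<longlonglongrightarrow> x)"
proof -
  have R: "0 \<le> R" using x0 is_norm_nonneg[OF N, of "x0 - x"] by simp
  define Y where "Y j = (T ^^ j) x0" for j
  have Y: "N (Y j - x) \<le> R \<and> N (Y j - x) \<le> R * (1/2) ^ j" for j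
  proof (induction j)
    case 0
    then show ?case using x0 by (simp add: Y_def)
  next
    case (Suc j)
    then have "N (Y (Suc j) - x) \<le> N (Y j - x) / 5" using contr by (simp add: Y_def)
    then show ?case using Suc is_norm_nonneg[OF N, of "Y j - x"] R by simp
  qed
  have path: "(\<forall>j. W (Y j) \<and> A (Y j) (Y (Suc j))) \<and> Y 0 = x0"
    using Y wd T by (simp add: Y_def)
  have uniq: "X = Y" if "(\<forall>j. W (X j) \<and> A (X j) (X (Suc j))) \<and> X 0 = x0" for X
  proof
    fix j show "X j = Y j"
    proof (induction j)
      case 0
      then show ?case using that by (simp add: Y_def)
    next
      case (Suc j)
      have "A (X j) (X (Suc j))" using that by blast
      then show ?case using Suc T[of "Y j"] Y[of j] by (simp add: Y_def)
    qed
  qed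
  have "Y \<longlonglongrightarrow> x" using Y by (intro is_norm_geometric_tendsto[OF N]) blast
  with path uniq show ?thesis by blast
qed

lemma two_step_iteration:
  fixes T :: "'a::euclidean_space \<Rightarrow> 'a \<Rightarrow> 'a"
  assumes N: "is_norm N"
    and wd: "\<And>a. N (a - x) \<le> R \<Longrightarrow> W a"
    and T: "\<And>a b y. N (a - x) \<le> R \<Longrightarrow> N (b - x) \<le> R \<Longrightarrow> A a b y \<longleftrightarrow> y = T a b"
    and contr: "\<And>a b. N (a - x) \<le> R \<Longrightarrow> N (b - x) \<le> R \<Longrightarrow>
      N (T a b - x) \<le> max (N (a - x)) (N (b - x)) / 5"
    and x0: "N (x0 - x) \<le> R" and x1: "N (x1 - x) \<le> R"
  shows "(\<exists>!X. (\<forall>j. W (X j) \<and> A (X j) (X (Suc j)) (X (Suc (Suc j)))) \<and> X 0 = x0 \<and> X 1 = x1) \<and>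
    (\<forall>X. (\<forall>j. W (X j) \<and> A (X j) (X (Suc j)) (X (Suc (Suc j)))) \<and> X 0 = x0 \<and> X 1 = x1 \<longrightarrow>
      X \<longlonglongrightarrow> x)"
proof -
  have R: "0 \<le> R" using x0 is_norm_nonneg[OF N, of "x0 - x"] by simp
  \<comment> \<open>The two-step recursion is iterated on pairs of consecutive points.\<close>
  define Y where "Y j = fst (((\<lambda>(a, b). (b, T a b)) ^^ j) (x0, x1))" for j
  have "snd (((\<lambda>(a, b). (b, T a b)) ^^ j) (x0, x1)) = Y (Suc j)" for j
    by (simp add: Y_def case_prod_unfold)
  then have Y_rec: "Y 0 = x0" "Y 1 = x1" "Y (Suc (Suc j)) = T (Y j) (Y (Suc j))" for j
    by (simp_all add: Y_def case_prod_unfold)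
  \<comment> \<open>The factor 2 makes the bound equal to \<open>R\<close> at index 1, so both
    starting points satisfy it. Two steps must gain a factor 1/4, and the contraction gives
    1/5.\<close>
  have Y: "(N (Y j - x) \<le> R \<and> N (Y j - x) \<le> 2 * R * (1/2) ^ j) \<and>
      (N (Y (Suc j) - x) \<le> R \<and> N (Y (Suc j) - x) \<le> 2 * R * (1/2) ^ Suc j)" for j
  proof (induction j)
    case 0
    then show ?case using x0 x1 R Y_rec(1,2) by simp
  next
    case (Suc j)
    define m where "m = max (N (Y j - x)) (N (Y (Suc j) - x))"
    have "0 \<le> R * (1/2) ^ j" using R by simp
    then have m: "m \<le> R" "m \<le> 2 * R * (1/2) ^ j"
      using Suc by (auto simp: m_def)
    have "N (Y (Suc (Suc j)) - x) \<le> m / 5"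
      using contr[of "Y j" "Y (Suc j)"] Suc by (simp add: Y_rec m_def)
    moreover have "m / 5 \<le> R" using m R by simp
    moreover have "m / 5 \<le> 2 * R * (1/2) ^ Suc (Suc j)"
      using m \<open>0 \<le> R * (1/2) ^ j\<close> by simp
    ultimately show ?case using Suc by linarith
  qed
  have path: "(\<forall>j. W (Y j) \<and> A (Y j) (Y (Suc j)) (Y (Suc (Suc j)))) \<and> Y 0 = x0 \<and> Y 1 = x1"
    using Y wd T Y_rec by blast
  have uniq: "X = Y"
    if X: "(\<forall>j. W (X j) \<and> A (X j) (X (Suc j)) (X (Suc (Suc j)))) \<and> X 0 = x0 \<and> X 1 = x1" for X
  proof
    have "X j = Y j \<and> X (Suc j) = Y (Suc j)" for j
    proof (induction j)
      case 0
      then show ?case using X Y_rec(1,2) by simp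
    next
      case (Suc j)
      have "A (X j) (X (Suc j)) (X (Suc (Suc j)))" using X by blast
      then show ?case using Suc T[of "Y j" "Y (Suc j)"] Y[of j] Y_rec(3)[of j] by simp
    qed
    then show "X j = Y j" for j by blast
  qed
  have "Y \<longlonglongrightarrow> x" using Y by (intro is_norm_geometric_tendsto[OF N]) blast
  with path uniq show ?thesis by blast
qed

text \<open>The root \<open>y\<close> is inserted into the linearization at \<open>x\<close>, where
  \<open>\<kappa>\<close> bounds its error by the value; this value is the difference of the two
  linearizations at \<open>y\<close>. The estimate for that difference holds for every argument, so
  \<open>y\<close> may lie outside \<open>K\<close>.\<close>

lemma secant_root_contraction:
  assumes N: "is_norm N" and soc: "second_order_constant N P F K \<gamma>" and \<gamma>: "\<gamma> > 0" and \<kappa>: "\<kappa> > 0"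
    and \<kappa>_le: "\<forall>y. N (y - x) \<le> \<kappa> * N (secant_lin P x x y)"
    and K: "x \<in> K" "xc \<in> K" "xh \<in> K"
    and m: "N (xc - x) \<le> m" "N (xh - x) \<le> m" "\<kappa> * \<gamma> * m \<le> 1/6"
    and root: "secant_lin P xc xh y = 0"
  shows "N (y - x) \<le> m / 5"
proof -
  let ?e = "N (y - x)"
  have e: "0 \<le> ?e" by (rule is_norm_nonneg[OF N])
  have m0: "0 \<le> m" using m(1) is_norm_nonneg[OF N, of "xc - x"] by simp
  have "N (secant_lin P x x y - secant_lin P xc xh y)
      \<le> \<gamma> * max (N (x - xh) * max (N (y - xc)) (N (y - x)))
                (N (x - xc) * max (N (y - xh)) (N (y - x)))"
    using soc K unfolding second_order_constant_def by blast
  also have "\<dots> \<le> \<gamma> * (m * (?e + m))"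
  proof (intro mult_left_mono max.boundedI mult_mono)
    show "N (x - xh) \<le> m" "N (x - xc) \<le> m"
      using m is_norm_minus_commute[OF N] by metis+
    show "N (y - xc) \<le> ?e + m" "N (y - xh) \<le> ?e + m"
      using is_norm_triangle[OF N, of y _ x] m by (meson add_left_mono order_trans)+
    show "?e \<le> ?e + m" using m0 by simp
    show "?e \<le> ?e + m" using m0 by simp
    show "0 \<le> max (N (y - xc)) ?e" "0 \<le> max (N (y - xh)) ?e" using e by (simp_all add: le_max_iff_disj)
  qed (use m0 \<gamma> in auto)
  finally have "N (secant_lin P x x y) \<le> \<gamma> * (m * (?e + m))" by (simp add: root)
  then have "\<kappa> * N (secant_lin P x x y) \<le> \<kappa> * (\<gamma> * (m * (?e + m)))"
    using \<kappa> by (intro mult_left_mono) auto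
  then have "?e \<le> \<kappa> * \<gamma> * m * (?e + m)"
    using \<kappa>_le[rule_format, of y] by (simp add: mult.assoc)
  also have "\<dots> \<le> 1/6 * (?e + m)" using m(3) e m0 by (intro mult_right_mono) auto
  finally show ?thesis by simp
qed

theorem theorem4p4:
  fixes N :: "real^'n \<Rightarrow> real"
    and \<Phi> :: "((real \<Rightarrow> real) \<times> real set) set"
    and P :: "'n procedure"
    and F :: "real^'n \<Rightarrow> real^'n"
    and xstar :: "real^'n"
    and K :: "(real^'n) set"
    and \<gamma> \<kappa> :: real
  assumes "is_norm N"
    and "elemental_library \<Phi>"
    and "procedure_over \<Phi> P"
    and "\<forall>x\<in>K. computes_near P F x"
    and "F xstar = 0"
    and "invertible (anf_J (tangent_anf P xstar))"
    and "abs_count P \<le> CARD('n)"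
    and "stably_coherently_oriented (tangent_anf P xstar) \<or>
         stably_bijective (tangent_anf P xstar) \<or>
         under_small_perturbations coherently_oriented (tangent_anf P xstar) \<or>
         under_small_perturbations bij (tangent_anf P xstar) \<or>
         ave_uniquely_solvable (abs_count P) (ave_matrix (tangent_anf P xstar))"
    and "convex K" and "xstar \<in> interior K"
    and "\<gamma> > 0" and "second_order_constant N P F K \<gamma>"
    and "\<kappa> > 0" and "\<forall>x. N (x - xstar) \<le> \<kappa> * N (tangent_lin P xstar x)"
  shows "\<exists>\<rho>>0.
    norm_ball N xstar \<rho> \<subseteq> K \<and>
    (\<forall>xo\<in>norm_ball N xstar \<rho>. bij (tangent_lin P xo)) \<and>
    (\<forall>xc\<in>norm_ball N xstar \<rho>. \<forall>xh\<in>norm_ball N xstar \<rho>. bij (secant_lin P xc xh)) \<and>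
    (let R = 1/3 * min \<rho> (1 / (2 * \<kappa> * \<gamma>)) in
      (\<forall>x0\<in>norm_cball N xstar R.
         (\<exists>!X. tangent_newton_path N P X \<and> X 0 = x0) \<and>
         (\<forall>X. tangent_newton_path N P X \<and> X 0 = x0 \<longrightarrow> X \<longlonglongrightarrow> xstar)) \<and>
      (\<forall>x0\<in>norm_cball N xstar R. \<forall>x1\<in>norm_cball N xstar R.
         (\<exists>!X. secant_newton_path N P X \<and> X 0 = x0 \<and> X 1 = x1) \<and>
         (\<forall>X. secant_newton_path N P X \<and> X 0 = x0 \<and> X 1 = x1 \<longrightarrow> X \<longlonglongrightarrow> xstar)))"
proof -
  note N = assms(1) and lib = assms(2) and P = assms(3) and \<gamma> = assms(11) and soc = assms(12)
    and \<kappa> = assms(13)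
  have wd: "well_defined_at P x" if "x \<in> K" for x
    using assms(4) that eventually_nhds_x_imp_x unfolding computes_near_def by blast
  have xK: "xstar \<in> K" using assms(10) interior_subset by blast
  have "slope_regular (tangent_anf P xstar)"
    using is_anf_tangent_anf[OF lib P wd[OF xK]] assms(6-8) by (intro slope_regular_if_stable) simp_all
  then obtain \<delta> where \<delta>: "\<delta> > 0"
    "\<And>xc xh. dist xc xstar < \<delta> \<Longrightarrow> dist xh xstar < \<delta> \<Longrightarrow> bij (secant_lin P xc xh)"
    using secant_lin_bij_near[OF lib P wd[OF xK]] by blast
  obtain e where e: "e > 0" "ball xstar e \<subseteq> K" using assms(10) by (meson mem_interior)
  obtain c where c: "c > 0" "\<And>x. c * norm x \<le> N x" using is_norm_ge_norm[OF N] by blast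
  \<comment> \<open>The factor \<open>c\<close> converts distances in \<open>N\<close> into
    Euclidean ones; \<open>\<delta>\<close> then gives bijectivity and \<open>e\<close> membership
    in \<open>K\<close>.\<close>
  define \<rho> where "\<rho> = c * min \<delta> e"
  have \<rho>: "\<rho> > 0" using c(1) \<delta>(1) e(1) by (simp add: \<rho>_def)
  have near: "dist x xstar < \<delta>" "x \<in> K" if "N (x - xstar) < \<rho>" for x
  proof -
    have "c * norm (x - xstar) < c * min \<delta> e" using c(2)[of "x - xstar"] that by (simp add: \<rho>_def)
    then have "dist x xstar < min \<delta> e" using c(1) by (simp add: dist_norm)
    then show "dist x xstar < \<delta>" "x \<in> K" using e(2) by (auto simp: dist_commute)
  qed
  have bij: "bij (secant_lin P xc xh)" if "N (xc - xstar) < \<rho>" "N (xh - xstar) < \<rho>" for xc xh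
    using near that \<delta>(2) by blast
  define R where "R = 1/3 * min \<rho> (1 / (2 * \<kappa> * \<gamma>))"
  \<comment> \<open>The factor 1/3 puts the closed ball strictly inside the ball of radius
    \<open>\<rho>\<close>; the second argument of the minimum yields the bound 1/6 that the
    contraction asks for.\<close>
  have R: "R < \<rho>" "\<kappa> * \<gamma> * R \<le> 1/6"
  proof -
    have "0 < 1 / (2 * \<kappa> * \<gamma>)" using \<kappa> \<gamma> by simp
    then show "R < \<rho>" using \<rho> by (simp add: R_def min_def)
    have "\<kappa> * \<gamma> * R \<le> \<kappa> * \<gamma> * (1/3 * (1 / (2 * \<kappa> * \<gamma>)))"
      unfolding R_def using \<kappa> \<gamma> by (intro mult_left_mono) auto
    also have "\<dots> = 1/6" using \<kappa> \<gamma> by simp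
    finally show "\<kappa> * \<gamma> * R \<le> 1/6" .
  qed
  have in_K: "x \<in> K" "well_defined_at P x" "N (x - xstar) < \<rho>" if "N (x - xstar) \<le> R" for x
    using that R(1) near(2)[of x] wd by auto
  \<comment> \<open>The case \<open>a = b\<close> is the step of the tangent method.\<close>
  have contr: "N (inv (secant_lin P a b) 0 - xstar) \<le> max (N (a - xstar)) (N (b - xstar)) / 5"
    if "N (a - xstar) \<le> R" "N (b - xstar) \<le> R" for a b
  proof (rule secant_root_contraction[OF N soc \<gamma> \<kappa>])
    show "\<forall>y. N (y - xstar) \<le> \<kappa> * N (secant_lin P xstar xstar y)"
      using assms(14) by (simp add: tangent_lin_eq_secant_lin)
    have "\<kappa> * \<gamma> * max (N (a - xstar)) (N (b - xstar)) \<le> \<kappa> * \<gamma> * R"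
      using that \<kappa> \<gamma> by (intro mult_left_mono) auto
    then show "\<kappa> * \<gamma> * max (N (a - xstar)) (N (b - xstar)) \<le> 1/6" using R(2) by simp
    show "secant_lin P a b (inv (secant_lin P a b) 0) = 0"
      by (rule surj_f_inv_f[OF bij_is_surj[OF bij[OF in_K(3)[OF that(1)] in_K(3)[OF that(2)]]]])
    show "a \<in> K" "b \<in> K" using in_K(1) that by simp_all
  qed (use xK in simp_all)
  have tangent: "(\<exists>!X. tangent_newton_path N P X \<and> X 0 = x0) \<and>
      (\<forall>X. tangent_newton_path N P X \<and> X 0 = x0 \<longrightarrow> X \<longlonglongrightarrow> xstar)" if "N (x0 - xstar) \<le> R" for x0
    unfolding tangent_newton_path_def
  proof (rule one_step_iteration[OF N, where T = "\<lambda>a. inv (secant_lin P a a) 0"])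
    fix a y assume a: "N (a - xstar) \<le> R"
    show "is_arg_min (\<lambda>x. N (x - a)) (\<lambda>x. tangent_lin P a x = 0) y \<longleftrightarrow> y = inv (secant_lin P a a) 0"
      unfolding tangent_lin_eq_secant_lin
      by (rule is_arg_min_root_iff[OF bij[OF in_K(3)[OF a] in_K(3)[OF a]]])
    show "N (inv (secant_lin P a a) 0 - xstar) \<le> N (a - xstar) / 5"
      using contr[OF a a] by simp
  qed (use in_K(2) that in simp_all)
  have secant: "(\<exists>!X. secant_newton_path N P X \<and> X 0 = x0 \<and> X 1 = x1) \<and>
      (\<forall>X. secant_newton_path N P X \<and> X 0 = x0 \<and> X 1 = x1 \<longrightarrow> X \<longlonglongrightarrow> xstar)"
    if "N (x0 - xstar) \<le> R" "N (x1 - xstar) \<le> R" for x0 x1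
    unfolding secant_newton_path_def
  proof (rule two_step_iteration[OF N, where T = "\<lambda>a b. inv (secant_lin P a b) 0" and
        A = "\<lambda>a b. is_arg_min (\<lambda>x. N (x - (1/2) *\<^sub>R (b + a))) (\<lambda>x. secant_lin P a b x = 0)"])
    fix a b y assume a: "N (a - xstar) \<le> R" and b: "N (b - xstar) \<le> R"
    show "is_arg_min (\<lambda>x. N (x - (1/2) *\<^sub>R (b + a))) (\<lambda>x. secant_lin P a b x = 0) y \<longleftrightarrow>
        y = inv (secant_lin P a b) 0"
      by (rule is_arg_min_root_iff[OF bij[OF in_K(3)[OF a] in_K(3)[OF b]]])
    show "N (inv (secant_lin P a b) 0 - xstar) \<le> max (N (a - xstar)) (N (b - xstar)) / 5"
      using contr[OF a b] .
  qed (use in_K(2) that in simp_all)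
  show ?thesis
  proof (intro exI[of _ \<rho>] conjI)
    show "norm_ball N xstar \<rho> \<subseteq> K" using near(2) by (auto simp: norm_ball_def)
    show "\<forall>xo\<in>norm_ball N xstar \<rho>. bij (tangent_lin P xo)"
      "\<forall>xc\<in>norm_ball N xstar \<rho>. \<forall>xh\<in>norm_ball N xstar \<rho>. bij (secant_lin P xc xh)"
      using bij by (auto simp: norm_ball_def tangent_lin_eq_secant_lin)
    show "let R = 1/3 * min \<rho> (1 / (2 * \<kappa> * \<gamma>)) in
      (\<forall>x0\<in>norm_cball N xstar R.
         (\<exists>!X. tangent_newton_path N P X \<and> X 0 = x0) \<and>
         (\<forall>X. tangent_newton_path N P X \<and> X 0 = x0 \<longrightarrow> X \<longlonglongrightarrow> xstar)) \<and>
      (\<forall>x0\<in>norm_cball N xstar R. \<forall>x1\<in>norm_cball N xstar R.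
         (\<exists>!X. secant_newton_path N P X \<and> X 0 = x0 \<and> X 1 = x1) \<and>
         (\<forall>X. secant_newton_path N P X \<and> X 0 = x0 \<and> X 1 = x1 \<longrightarrow> X \<longlonglongrightarrow> xstar))"
      unfolding R_def[symmetric] Let_def norm_cball_def
      using tangent secant by blast
  qed (rule \<rho>)
qed

end
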